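(* There is a one-to-one correspondence between skeletal $2$-term bihom-$A_\infty$-algebras and tuples $((A,m,\alpha,\beta),M,\cdot,\alpha_M,\beta_M,\theta)$, where $A=(A,m,\alpha,\beta)$ is a bihom-associative algebra, $(M,\cdot,\alpha_M,\beta_M)$ is a bimodule over $A$, and $\theta$ is a $3$-cocycle of the bihom-associative algebra $A$ with coefficients in the bimodule $M$.
   Context: All vector spaces and linear maps are over a field $\mathbb{K}$ of characteristic zero. A bihom-$A_\infty$-algebra $(A,m_k,\alpha,\beta)$ is a graded vector space $A=\bigoplus A_i$ with linear maps $m_k:A^{\otimes k}\to A$ of degree $k-2$ for $1\le k<\infty$, and two commuting linear maps $\alpha,\beta:A\to A$ of degree $0$ with $\alpha\circ m_k=m_k\circ\alpha^{\otimes k}$ and $\beta\circ m_k=m_k\circ\beta^{\otimes k}$ for all $k$, such that for all $n\ge1$ and homogeneous $a_i\in A_{|a_i|}$, $$\sum_{i+j=n+1}\sum_{\lambda=1}^{j}(-1)^{\lambda(i+1)+i(|a_1|+\dots+|a_{\lambda-1}|)}m_j\big(\alpha^{i-1}a_1,\dots,\alpha^{i-1}a_{\lambda-1},m_i(a_\lambda,\dots,a_{\lambda+i-1}),\beta^{i-1}a_{\lambda+i},\dots,\beta^{i-1}a_n\big)=0.$$ It is $2$-term if $A=A_0\oplus A_1$ is concentrated in degrees $0,1$; then $m_k=0$ for $k>3$, and one writes it as $(A_1\xrightarrow{d}A_0,m_2,m_3,\alpha_0,\beta_0,\alpha_1,\beta_1)$ with $d=m_1$ and $\alpha_i,\beta_i$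 the components of $\alpha,\beta$ on $A_i$. It is skeletal if $d=0$. A bihom-associative algebra $(A,m,\alpha,\beta)$ is a vector space $A$ with a bilinear map $m:A\times A\to A$ and two commuting linear maps $\alpha,\beta:A\to A$ such that $\alpha(m(a,b))=m(\alpha(a),\alpha(b))$, $\beta(m(a,b))=m(\beta(a),\beta(b))$ and $m(\alpha(a),m(b,c))=m(m(a,b),\beta(c))$. An $A$-bimodule $(M,\cdot,\alpha_M,\beta_M)$ is a vector space $M$ with bilinear actions $a\cdot x$ and $x\cdot a$ ($a\in A$, $x\in M$) and commuting linear maps $\alpha_M,\beta_M:M\to M$ such that $\alpha_M(a\cdot x)=\alpha(a)\cdot\alpha_M(x)$, $\beta_M(a\cdot x)=\beta(a)\cdot\beta_M(x)$, $\alpha_M(x\cdot a)=\alpha_M(x)\cdot\alpha(a)$, $\beta_M(x\cdot a)=\beta_M(x)\cdot\beta(a)$, $\alpha(a)\cdot(b\cdot x)=m(a,b)\cdot\beta_M(x)$, $\alpha_M(x)\cdot m(a,b)=(x\cdot a)\cdot\beta(b)$, $\alpha(a)\cdot(x\cdot b)=(a\cdot x)\cdot\beta(b)$. $n$-cochains of $A$ with coefficients in $M$ are linear maps $f:A^{\otimes n}\to M$ with $\alpha_M\circ f=f\circ\alpha^{\otimes n}$, $\beta_M\circ f=f\circ\beta^{\otimes n}$; the coboundary is $$(\delta_{\mathrm{Hoch}}f)(a_1,\dots,a_{n+1})=\alpha^{n-1}(a_1)\cdot f(a_2,\dots,a_{n+1})+\sum_{i=1}^n(-1)^if(\alpha(a_1),\dots,\alpha(a_{i-1}),m(a_i,a_{i+1}),\beta(a_{i+2}),\dots,\beta(a_{n+1}))+(-1)^{n+1}f(a_1,\dots,a_n)\cdot\beta^{n-1}(a_{n+1}),$$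 and an $n$-cocycle is an $n$-cochain $f$ with $\delta_{\mathrm{Hoch}}f=0$. *)

theory Defs
  imports Complex_Main "HOL-Library.FuncSet" "HOL-Library.Poly_Mapping"
begin

text \<open>
  A vector space is a subspace of an ambient vector space on a type; the ambient space only serves
  as a universe, so that underlying spaces can vary. Maps are extensional: they are
  \<open>undefined\<close> off their domains, so that equality of structures is equality in HOL. A linear map
  on a tensor power is a multilinear map on lists of the given length.
\<close>

definition linear_on ::
  "('k \<Rightarrow> 'v \<Rightarrow> 'v::ab_group_add) \<Rightarrow> ('k \<Rightarrow> 'w \<Rightarrow> 'w::ab_group_add) \<Rightarrow> 'v set \<Rightarrow> 'w set \<Rightarrow> ('v \<Rightarrow> 'w) \<Rightarrow> bool"
  where "linear_on s t V W f \<longleftrightarrow> f \<in> V \<rightarrow> W \<and>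
    (\<forall>x\<in>V. \<forall>y\<in>V. f (x + y) = f x + f y) \<and> (\<forall>c. \<forall>x\<in>V. f (s c x) = t c (f x))"

definition bilinear_on ::
  "('k \<Rightarrow> 'v \<Rightarrow> 'v::ab_group_add) \<Rightarrow> 'v set \<Rightarrow> 'v set \<Rightarrow> 'v set \<Rightarrow> ('v \<Rightarrow> 'v \<Rightarrow> 'v) \<Rightarrow> bool"
  where "bilinear_on s U V W f \<longleftrightarrow>
    (\<forall>u\<in>U. linear_on s s V W (\<lambda>v. f u v)) \<and> (\<forall>v\<in>V. linear_on s s U W (\<lambda>u. f u v))"

definition tuples :: "nat \<Rightarrow> 'v set \<Rightarrow> 'v list set"
  where "tuples n V = {xs. set xs \<subseteq> V \<and> length xs = n}"

definition multilinear_on ::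
  "('k \<Rightarrow> 'v \<Rightarrow> 'v::ab_group_add) \<Rightarrow> ('k \<Rightarrow> 'w \<Rightarrow> 'w::ab_group_add) \<Rightarrow> nat \<Rightarrow> 'v set \<Rightarrow> 'w set
    \<Rightarrow> ('v list \<Rightarrow> 'w) \<Rightarrow> bool"
  where "multilinear_on s t n V W f \<longleftrightarrow> f \<in> tuples n V \<rightarrow> W \<and>
    (\<forall>xs\<in>tuples n V. \<forall>i<n. linear_on s t V W (\<lambda>x. f (xs[i := x])))"


section \<open>Bihom-associative algebras, bimodules, Hochschild cocycles\<close>

record 'v bihom_alg =
  aspace :: "'v set"
  amult :: "'v \<Rightarrow> 'v \<Rightarrow> 'v"
  alpha :: "'v \<Rightarrow> 'v"
  beta :: "'v \<Rightarrow> 'v"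

record 'v bihom_bimod =
  mspace :: "'v set"
  lact :: "'v \<Rightarrow> 'v \<Rightarrow> 'v"
  ract :: "'v \<Rightarrow> 'v \<Rightarrow> 'v"
  malpha :: "'v \<Rightarrow> 'v"
  mbeta :: "'v \<Rightarrow> 'v"

definition bihom_associative ::
  "('k::field \<Rightarrow> 'v \<Rightarrow> 'v::ab_group_add) \<Rightarrow> 'v bihom_alg \<Rightarrow> bool"
  where "bihom_associative s \<A> \<longleftrightarrow>
    (let A = aspace \<A>; m = amult \<A>; \<alpha> = alpha \<A>; \<beta> = beta \<A> in
      module.subspace s A \<and>
      m \<in> A \<rightarrow>\<^sub>E A \<rightarrow>\<^sub>E A \<and> bilinear_on s A A A m \<and>
      \<alpha> \<in> A \<rightarrow>\<^sub>E A \<and> linear_on s s A A \<alpha> \<and>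
      \<beta> \<in> A \<rightarrow>\<^sub>E A \<and> linear_on s s A A \<beta> \<and>
      (\<forall>a\<in>A. \<alpha> (\<beta> a) = \<beta> (\<alpha> a)) \<and>
      (\<forall>a\<in>A. \<forall>b\<in>A. \<alpha> (m a b) = m (\<alpha> a) (\<alpha> b) \<and> \<beta> (m a b) = m (\<beta> a) (\<beta> b)) \<and>
      (\<forall>a\<in>A. \<forall>b\<in>A. \<forall>c\<in>A. m (\<alpha> a) (m b c) = m (m a b) (\<beta> c)))"

definition bihom_bimodule ::
  "('k::field \<Rightarrow> 'v \<Rightarrow> 'v::ab_group_add) \<Rightarrow> 'v bihom_alg \<Rightarrow> 'v bihom_bimod \<Rightarrow> bool"
  where "bihom_bimodule s \<A> \<M> \<longleftrightarrow>
    (let A = aspace \<A>; m = amult \<A>; \<alpha> = alpha \<A>; \<beta> = beta \<A>;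
         M = mspace \<M>; l = lact \<M>; r = ract \<M>; \<alpha>M = malpha \<M>; \<beta>M = mbeta \<M> in
      module.subspace s M \<and>
      l \<in> A \<rightarrow>\<^sub>E M \<rightarrow>\<^sub>E M \<and> bilinear_on s A M M l \<and>
      r \<in> M \<rightarrow>\<^sub>E A \<rightarrow>\<^sub>E M \<and> bilinear_on s M A M r \<and>
      \<alpha>M \<in> M \<rightarrow>\<^sub>E M \<and> linear_on s s M M \<alpha>M \<and>
      \<beta>M \<in> M \<rightarrow>\<^sub>E M \<and> linear_on s s M M \<beta>M \<and>
      (\<forall>x\<in>M. \<alpha>M (\<beta>M x) = \<beta>M (\<alpha>M x)) \<and>
      (\<forall>a\<in>A. \<forall>x\<in>M.
        \<alpha>M (l a x) = l (\<alpha> a) (\<alpha>M x) \<and> \<beta>M (l a x) = l (\<beta> a) (\<beta>M x) \<and>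
        \<alpha>M (r x a) = r (\<alpha>M x) (\<alpha> a) \<and> \<beta>M (r x a) = r (\<beta>M x) (\<beta> a)) \<and>
      (\<forall>a\<in>A. \<forall>b\<in>A. \<forall>x\<in>M.
        l (\<alpha> a) (l b x) = l (m a b) (\<beta>M x) \<and>
        r (\<alpha>M x) (m a b) = r (r x a) (\<beta> b) \<and>
        l (\<alpha> a) (r x b) = r (l a x) (\<beta> b)))"

definition hoch_cochain ::
  "('k::field \<Rightarrow> 'v \<Rightarrow> 'v::ab_group_add) \<Rightarrow> 'v bihom_alg \<Rightarrow> 'v bihom_bimod \<Rightarrow> nat \<Rightarrow> ('v list \<Rightarrow> 'v) \<Rightarrow> bool"
  where "hoch_cochain s \<A> \<M> n f \<longleftrightarrow>
    f \<in> tuples n (aspace \<A>) \<rightarrow>\<^sub>E mspace \<M> \<and>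
    multilinear_on s s n (aspace \<A>) (mspace \<M>) f \<and>
    (\<forall>as\<in>tuples n (aspace \<A>).
      malpha \<M> (f as) = f (map (alpha \<A>) as) \<and> mbeta \<M> (f as) = f (map (beta \<A>) as))"

text \<open>The argument \<open>a\<^sub>i\<close> of the usual formula is \<open>as ! (i - 1)\<close>; the degree satisfies \<open>n \<ge> 1\<close>.\<close>

definition hoch_coboundary ::
  "('k::field \<Rightarrow> 'v \<Rightarrow> 'v::ab_group_add) \<Rightarrow> 'v bihom_alg \<Rightarrow> 'v bihom_bimod \<Rightarrow> nat
    \<Rightarrow> ('v list \<Rightarrow> 'v) \<Rightarrow> 'v list \<Rightarrow> 'v"
  where "hoch_coboundary s \<A> \<M> n f as =
    lact \<M> ((alpha \<A> ^^ (n - 1)) (as ! 0)) (f (drop 1 as))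
    + (\<Sum>i=1..n. s ((-1) ^ i)
        (f (map (alpha \<A>) (take (i - 1) as) @ [amult \<A> (as ! (i - 1)) (as ! i)]
            @ map (beta \<A>) (drop (i + 1) as))))
    + s ((-1) ^ (n + 1)) (ract \<M> (f (take n as)) ((beta \<A> ^^ (n - 1)) (as ! n)))"

definition hoch_cocycle ::
  "('k::field \<Rightarrow> 'v \<Rightarrow> 'v::ab_group_add) \<Rightarrow> 'v bihom_alg \<Rightarrow> 'v bihom_bimod \<Rightarrow> nat \<Rightarrow> ('v list \<Rightarrow> 'v) \<Rightarrow> bool"
  where "hoch_cocycle s \<A> \<M> n f \<longleftrightarrow> hoch_cochain s \<A> \<M> n f \<and>
    (\<forall>as\<in>tuples (n + 1) (aspace \<A>). hoch_coboundary s \<A> \<M> n f as = 0)"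


section \<open>Bihom-\<open>A\<^sub>\<infinity>\<close>-algebras\<close>

text \<open>
  A graded vector space is a family \<open>V\<close> of vector spaces indexed by the integers. Its total space is
  the external direct sum, so the components need not be independent in the ambient space.
\<close>

definition total :: "(int \<Rightarrow> 'v set) \<Rightarrow> (int \<Rightarrow>\<^sub>0 'v::zero) set"
  where "total V = {f. \<forall>p. Poly_Mapping.lookup f p \<in> V p}"

definition homog :: "(int \<Rightarrow> 'v set) \<Rightarrow> int \<Rightarrow> (int \<Rightarrow>\<^sub>0 'v::zero) set"
  where "homog V p = Poly_Mapping.single p ` V p"

definition gscale :: "('k \<Rightarrow> 'v \<Rightarrow> 'v) \<Rightarrow> 'k \<Rightarrow> (int \<Rightarrow>\<^sub>0 'v) \<Rightarrow> (int \<Rightarrow>\<^sub>0 'v::zero)"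
  where "gscale s c f = Poly_Mapping.map (s c) f"

record (overloaded) ('v::zero) bihom_ainf =
  component :: "int \<Rightarrow> 'v set"
  mult :: "nat \<Rightarrow> (int \<Rightarrow>\<^sub>0 'v) list \<Rightarrow> (int \<Rightarrow>\<^sub>0 'v)"
  galpha :: "(int \<Rightarrow>\<^sub>0 'v) \<Rightarrow> (int \<Rightarrow>\<^sub>0 'v)"
  gbeta :: "(int \<Rightarrow>\<^sub>0 'v) \<Rightarrow> (int \<Rightarrow>\<^sub>0 'v)"

text \<open>
  In the summand of the defining identity, \<open>j = n + 1 - i\<close>, and \<open>ps\<close> lists the degrees of the
  homogeneous arguments. There is no \<open>m\<^sub>0\<close>, so \<open>mult\<close> is \<open>undefined\<close> at \<open>0\<close>.
\<close>

definition bihom_ainf_algebra ::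
  "('k::field \<Rightarrow> 'v \<Rightarrow> 'v::ab_group_add) \<Rightarrow> 'v bihom_ainf \<Rightarrow> bool"
  where "bihom_ainf_algebra s X \<longleftrightarrow>
    (let V = component X; A = total V; m = mult X; \<alpha> = galpha X; \<beta> = gbeta X; t = gscale s in
      (\<forall>p. module.subspace s (V p)) \<and>
      m \<in> extensional {1..} \<and>
      (\<forall>k\<ge>1. m k \<in> tuples k A \<rightarrow>\<^sub>E A \<and> multilinear_on t t k A A (m k) \<and>
        (\<forall>ps xs. length xs = k \<and> list_all2 (\<lambda>p x. x \<in> homog V p) ps xs
           \<longrightarrow> m k xs \<in> homog V (sum_list ps + int k - 2))) \<and>
      \<alpha> \<in> A \<rightarrow>\<^sub>E A \<and> linear_on t t A A \<alpha> \<and> (\<forall>p. \<alpha> \<in> homog V p \<rightarrow> homog V p) \<and>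
      \<beta> \<in> A \<rightarrow>\<^sub>E A \<and> linear_on t t A A \<beta> \<and> (\<forall>p. \<beta> \<in> homog V p \<rightarrow> homog V p) \<and>
      (\<forall>x\<in>A. \<alpha> (\<beta> x) = \<beta> (\<alpha> x)) \<and>
      (\<forall>k\<ge>1. \<forall>xs\<in>tuples k A. \<alpha> (m k xs) = m k (map \<alpha> xs) \<and> \<beta> (m k xs) = m k (map \<beta> xs)) \<and>
      (\<forall>n\<ge>1. \<forall>ps as. length as = n \<and> list_all2 (\<lambda>p a. a \<in> homog V p) ps as \<longrightarrow>
        (\<Sum>i=1..n. \<Sum>l=1..n + 1 - i.
          t ((-1) powi (int (l * (i + 1)) + int i * sum_list (take (l - 1) ps)))
            (m (n + 1 - i)
              (map (\<alpha> ^^ (i - 1)) (take (l - 1) as)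
               @ [m i (take i (drop (l - 1) as))]
               @ map (\<beta> ^^ (i - 1)) (drop (l + i - 1) as)))) = 0))"

definition two_term :: "('v::zero) bihom_ainf \<Rightarrow> bool"
  where "two_term X \<longleftrightarrow> (\<forall>p. p \<noteq> 0 \<and> p \<noteq> 1 \<longrightarrow> component X p = {0})"

text \<open>The differential \<open>d\<close> of a 2-term algebra is \<open>m\<^sub>1\<close> on the component of degree 1.\<close>

definition skeletal :: "('v::zero) bihom_ainf \<Rightarrow> bool"
  where "skeletal X \<longleftrightarrow> (\<forall>x\<in>homog (component X) 1. mult X 1 [x] = 0)"

definition skeletal_two_term_algebras ::
  "('k::field \<Rightarrow> 'v \<Rightarrow> 'v::ab_group_add) \<Rightarrow> 'v bihom_ainf set"
  where "skeletal_two_term_algebras s = {X. bihom_ainf_algebra s X \<and> two_term X \<and> skeletal X}"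

definition three_cocycle_tuples ::
  "('k::field \<Rightarrow> 'v \<Rightarrow> 'v::ab_group_add) \<Rightarrow> ('v bihom_alg \<times> 'v bihom_bimod \<times> ('v list \<Rightarrow> 'v)) set"
  where "three_cocycle_tuples s = {(\<A>, \<M>, \<theta>).
    bihom_associative s \<A> \<and> bihom_bimodule s \<A> \<M> \<and> hoch_cocycle s \<A> \<M> 3 \<theta>}"


section \<open>The correspondence\<close>

text \<open>
  The algebra is \<open>A\<^sub>0\<close> with \<open>m\<^sub>2\<close>, the bimodule is \<open>A\<^sub>1\<close> with the actions given by \<open>m\<^sub>2\<close>, and the
  cocycle is \<open>m\<^sub>3\<close> on \<open>A\<^sub>0\<close>.
\<close>

definition degree_zero_algebra :: "('v::zero) bihom_ainf \<Rightarrow> 'v bihom_alg"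
  where "degree_zero_algebra X = (let A = component X 0; e = Poly_Mapping.single 0 in
    \<lparr>aspace = A,
     amult = (\<lambda>a\<in>A. \<lambda>b\<in>A. Poly_Mapping.lookup (mult X 2 [e a, e b]) 0),
     alpha = (\<lambda>a\<in>A. Poly_Mapping.lookup (galpha X (e a)) 0),
     beta = (\<lambda>a\<in>A. Poly_Mapping.lookup (gbeta X (e a)) 0)\<rparr>)"

definition degree_one_bimodule :: "('v::zero) bihom_ainf \<Rightarrow> 'v bihom_bimod"
  where "degree_one_bimodule X =
    (let A = component X 0; M = component X 1; e = Poly_Mapping.single 0; u = Poly_Mapping.single 1 in
    \<lparr>mspace = M,
     lact = (\<lambda>a\<in>A. \<lambda>x\<in>M. Poly_Mapping.lookup (mult X 2 [e a, u x]) 1),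
     ract = (\<lambda>x\<in>M. \<lambda>a\<in>A. Poly_Mapping.lookup (mult X 2 [u x, e a]) 1),
     malpha = (\<lambda>x\<in>M. Poly_Mapping.lookup (galpha X (u x)) 1),
     mbeta = (\<lambda>x\<in>M. Poly_Mapping.lookup (gbeta X (u x)) 1)\<rparr>)"

definition ternary_cochain :: "('v::zero) bihom_ainf \<Rightarrow> 'v list \<Rightarrow> 'v"
  where "ternary_cochain X = (\<lambda>as\<in>tuples 3 (component X 0).
    Poly_Mapping.lookup (mult X 3 (map (Poly_Mapping.single 0) as)) 1)"

definition to_cocycle_tuple ::
  "('v::zero) bihom_ainf \<Rightarrow> 'v bihom_alg \<times> 'v bihom_bimod \<times> ('v list \<Rightarrow> 'v)"
  where "to_cocycle_tuple X = (degree_zero_algebra X, degree_one_bimodule X, ternary_cochain X)"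

end

theory Submission imports Defs begin

text \<open>
  In a 2-term algebra \<open>A\<^sub>0 \<oplus> A\<^sub>1\<close> the operation \<open>m\<^sub>k\<close> raises the total degree by \<open>k - 2\<close>, so on
  homogeneous arguments it can be nonzero only if the result has degree 0 or 1. Once \<open>d = m\<^sub>1\<close>
  vanishes, exactly four components survive: \<open>m\<^sub>2\<close> on \<open>A\<^sub>0 \<otimes> A\<^sub>0\<close>, \<open>A\<^sub>0 \<otimes> A\<^sub>1\<close> and \<open>A\<^sub>1 \<otimes> A\<^sub>0\<close>, and
  \<open>m\<^sub>3\<close> on \<open>A\<^sub>0 \<otimes> A\<^sub>0 \<otimes> A\<^sub>0\<close>. These are a product, a left and a right action, and a ternary cochain,
  and conversely any such data assemble into graded operations (\<open>skeletal_algebra\<close>). The two passages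
  are mutually inverse already for the underlying multilinear data, before any axiom is imposed:
  two multilinear maps that agree on homogeneous arguments are equal.

  It remains to match the axioms (\<open>skeletal_algebra_mem_iff\<close>). Compatibility of the operations with
  \<open>\<alpha>\<close> and \<open>\<beta>\<close> splits into components. In the quadratic identity of arity \<open>n\<close> a summand involves
  \<open>m\<^sub>i\<close> and \<open>m\<^sub>j\<close> with \<open>i + j = n + 1\<close>, hence only \<open>i, j \<in> {2, 3}\<close> matter:
  \<^item> for \<open>n = 3\<close> the identity reads \<open>m\<^sub>2(\<alpha>x, m\<^sub>2(y, z)) = m\<^sub>2(m\<^sub>2(x, y), \<beta>z)\<close>; with all arguments in
    degree 0 this is bihom-associativity, and with one argument in degree 1 it gives the three
    bimodule axioms, one for each position of that argument;
  \<^item> for \<open>n = 4\<close>, on degree-0 arguments, its five summands are, signs included, the five summands of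
    the Hochschild coboundary of \<open>m\<^sub>3\<close>, and on arguments of higher degree it is trivial;
  \<^item> for \<open>n = 5\<close> the only candidate \<open>m\<^sub>3(\<dots>, m\<^sub>3(\<dots>), \<dots>)\<close> has an argument in degree 1 and vanishes.
\<close>

section \<open>Linear and multilinear maps on subspaces\<close>

lemma linear_on_comp:
  assumes "linear_on s t U V f" "linear_on t u V W g"
  shows "linear_on s u U W (\<lambda>x. g (f x))"
  using assms by (auto simp: linear_on_def Pi_iff)

text \<open>
  Closure of \<open>V\<close> under the operations ensures that linearity only involves values on \<open>V\<close>, so that \<open>f\<close>
  may be changed off \<open>V\<close>, for instance to make it extensional.
\<close>

lemma linear_on_cong:
  assumes "linear_on s t V W f" "\<And>x. x \<in> V \<Longrightarrow> f x = g x"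
    and "module.subspace s V" "module s"
  shows "linear_on s t V W g"
  using assms by (auto simp: linear_on_def Pi_iff module.subspace_def)

lemma linear_on_zero:
  assumes "linear_on s t V W f" "0 \<in> V"
  shows "f 0 = 0"
  using assms unfolding linear_on_def by (metis add_cancel_right_right)

lemma bilinear_onD:
  assumes "bilinear_on s U V W f" "u \<in> U" "v \<in> V"
  shows "f u v \<in> W" "u' \<in> U \<Longrightarrow> f (u + u') v = f u v + f u' v" "v' \<in> V \<Longrightarrow> f u (v + v') = f u v + f u v'"
    "f (s c u) v = s c (f u v)" "f u (s c v) = s c (f u v)"
  using assms by (auto simp: bilinear_on_def linear_on_def)

lemma bilinear_on_zero:
  assumes "bilinear_on s U V W f"
  shows "0 \<in> U \<Longrightarrow> v \<in> V \<Longrightarrow> f 0 v = 0" "u \<in> U \<Longrightarrow> 0 \<in> V \<Longrightarrow> f u 0 = 0"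
  using assms linear_on_zero[of s s V W "f u"] linear_on_zero[of s s U W "\<lambda>u. f u v"]
  by (auto simp: bilinear_on_def)

lemma tuples_update: "xs \<in> tuples n V \<Longrightarrow> x \<in> V \<Longrightarrow> xs[i := x] \<in> tuples n V"
  by (auto simp: tuples_def dest!: set_update_subset_insert[THEN subsetD])

lemma multilinear_on_zero:
  assumes "multilinear_on s t n V W f" "xs \<in> tuples n V" "0 \<in> set xs"
  shows "f xs = 0"
proof -
  obtain i where i: "i < length xs" "xs ! i = 0" using assms(3) by (metis in_set_conv_nth)
  then have "linear_on s t V W (\<lambda>x. f (xs[i := x]))" "0 \<in> V"
    using assms by (auto simp: multilinear_on_def tuples_def)
  from linear_on_zero[OF this] show ?thesis using i by (metis list_update_id)
qed

text \<open>
  One argument after another is split as a sum of two elements of \<open>H\<close>; the induction is on the number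
  of leading arguments that are still arbitrary. For \<open>H\<close> the union of the homogeneous components, this
  reduces equalities of operations on a two-term space to homogeneous arguments.
\<close>

lemma multilinear_on_eqI:
  assumes f: "multilinear_on s t n V W f" and g: "multilinear_on s t n V W g"
    and gen: "\<And>x. x \<in> V \<Longrightarrow> \<exists>y\<in>H. \<exists>z\<in>H. x = y + z" and H: "H \<subseteq> V"
    and eq: "\<And>xs. xs \<in> tuples n H \<Longrightarrow> f xs = g xs"
    and xs: "xs \<in> tuples n V"
  shows "f xs = g xs"
proof -
  have "f xs = g xs" if "j \<le> n" "xs \<in> tuples n V" "\<forall>i<n. j \<le> i \<longrightarrow> xs ! i \<in> H" for j xs
    using that
  proof (induction j arbitrary: xs)
    case 0
    then have "xs \<in> tuples n H" by (auto simp: tuples_def in_set_conv_nth)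
    then show ?case by (rule eq)
  next
    case (Suc j)
    have j: "j < n" "length xs = n" "xs ! j \<in> V"
      using Suc.prems by (auto simp: tuples_def)
    obtain y z where yz: "y \<in> H" "z \<in> H" "xs ! j = y + z" using gen j by meson
    have split: "h xs = h (xs[j := y]) + h (xs[j := z])" if "multilinear_on s t n V W h" for h
    proof -
      have "linear_on s t V W (\<lambda>x. h (xs[j := x]))"
        using that Suc.prems(2) j by (auto simp: multilinear_on_def)
      then have "h (xs[j := y + z]) = h (xs[j := y]) + h (xs[j := z])"
        using yz H by (simp add: linear_on_def subset_iff)
      then show ?thesis using yz by (metis list_update_id)
    qed
    have "f (xs[j := w]) = g (xs[j := w])" if "w \<in> H" for w
      using that Suc.prems H j
      by (intro Suc.IH) (auto simp: tuples_update nth_list_update subsetD[OF H] Suc_le_eq less_le)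
    then show ?case using split[OF f] split[OF g] yz by simp
  qed
  from this[of n xs] xs show ?thesis by simp
qed

section \<open>The total space of a two-term graded space\<close>

definition pair_elt :: "'v::ab_group_add \<Rightarrow> 'v \<Rightarrow> int \<Rightarrow>\<^sub>0 'v"
  where "pair_elt a x = Poly_Mapping.single 0 a + Poly_Mapping.single 1 x"

definition two_term_space :: "'v::zero set \<Rightarrow> 'v set \<Rightarrow> int \<Rightarrow> 'v set"
  where "two_term_space A M p = (if p = 0 then A else if p = 1 then M else {0})"

lemma lookup_pair_elt [simp]:
  "Poly_Mapping.lookup (pair_elt a x) p = (if p = 0 then a else if p = 1 then x else 0)"
  by (auto simp: pair_elt_def lookup_add lookup_single when_def)

lemma pair_elt_eqI:
  assumes "\<And>p. p \<noteq> 0 \<Longrightarrow> p \<noteq> 1 \<Longrightarrow> Poly_Mapping.lookup f p = 0"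
  shows "f = pair_elt (Poly_Mapping.lookup f 0) (Poly_Mapping.lookup f 1)"
  by (rule poly_mapping_eqI) (use assms in auto)

lemma pair_elt_inject [simp]: "pair_elt a x = pair_elt b y \<longleftrightarrow> a = b \<and> x = y"
  by (metis lookup_pair_elt zero_neq_one)

lemma pair_elt_add [simp]: "pair_elt a x + pair_elt b y = pair_elt (a + b) (x + y)"
  by (rule poly_mapping_eqI) (auto simp: lookup_add)

lemma pair_elt_zero [simp]: "pair_elt 0 0 = 0"
  by (rule poly_mapping_eqI) auto

lemma single_0_eq_pair_elt: "Poly_Mapping.single 0 a = pair_elt a 0"
  and single_1_eq_pair_elt: "Poly_Mapping.single 1 x = pair_elt 0 x"
  by (simp_all add: pair_elt_def)

lemma total_two_term_space: "total (two_term_space A M) = {pair_elt a x |a x. a \<in> A \<and> x \<in> M}"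
proof (intro set_eqI iffI)
  fix f assume f: "f \<in> total (two_term_space A M)"
  then have mem: "Poly_Mapping.lookup f p \<in> two_term_space A M p" for p
    by (auto simp: total_def)
  have "f = pair_elt (Poly_Mapping.lookup f 0) (Poly_Mapping.lookup f 1)"
  proof (rule pair_elt_eqI)
    show "Poly_Mapping.lookup f p = 0" if "p \<noteq> 0" "p \<noteq> 1" for p
      using mem[of p] that by (simp add: two_term_space_def)
  qed
  moreover have "Poly_Mapping.lookup f 0 \<in> A" "Poly_Mapping.lookup f 1 \<in> M"
    using mem[of 0] mem[of 1] by (auto simp: two_term_space_def)
  ultimately show "f \<in> {pair_elt a x |a x. a \<in> A \<and> x \<in> M}" by blast
qed (auto simp: total_def two_term_space_def)

lemma homog_two_term_space:
  "homog (two_term_space A M) p =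
    (if p = 0 then (\<lambda>a. pair_elt a 0) ` A else if p = 1 then pair_elt 0 ` M else {0})"
  by (auto simp: homog_def two_term_space_def single_0_eq_pair_elt single_1_eq_pair_elt image_iff)

lemma gscale_lookup:
  assumes "vector_space s"
  shows "Poly_Mapping.lookup (gscale s c f) p = s c (Poly_Mapping.lookup f p)"
proof -
  interpret vector_space s by fact
  show ?thesis by (simp add: gscale_def map.rep_eq when_def)
qed

lemma gscale_pair_elt [simp]:
  assumes "vector_space s"
  shows "gscale s c (pair_elt a x) = pair_elt (s c a) (s c x)"
proof -
  interpret vector_space s by fact
  show ?thesis by (rule poly_mapping_eqI) (simp add: gscale_lookup[OF assms])
qed

lemma gscale_0 [simp]:
  assumes "vector_space s"
  shows "gscale s c 0 = 0"
proof -
  interpret vector_space s by fact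
  show ?thesis using gscale_pair_elt[OF assms, of c 0 0] by simp
qed

lemma linear_on_single:
  assumes "vector_space s" "\<And>p. 0 \<in> V p"
  shows "linear_on s (gscale s) (V p) (total V) (Poly_Mapping.single p)"
proof -
  interpret vector_space s by fact
  have "gscale s c (Poly_Mapping.single p x) = Poly_Mapping.single p (s c x)" for c x
    by (rule poly_mapping_eqI) (simp add: gscale_lookup[OF assms(1)] lookup_single when_def)
  then show ?thesis
    using assms(2) by (auto simp: linear_on_def single_add total_def lookup_single when_def)
qed

lemma linear_on_lookup:
  assumes "vector_space s"
  shows "linear_on (gscale s) s (total V) (V p) (\<lambda>f. Poly_Mapping.lookup f p)"
  using gscale_lookup[OF assms] by (auto simp: linear_on_def total_def lookup_add)

lemma homog_eq_single: "f \<in> homog V p \<Longrightarrow> f = Poly_Mapping.single p (Poly_Mapping.lookup f p)"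
  by (auto simp: homog_def)

abbreviation deg0 :: "(int \<Rightarrow>\<^sub>0 'v::zero) \<Rightarrow> 'v" where "deg0 f \<equiv> Poly_Mapping.lookup f 0"
abbreviation deg1 :: "(int \<Rightarrow>\<^sub>0 'v::zero) \<Rightarrow> 'v" where "deg1 f \<equiv> Poly_Mapping.lookup f 1"

section \<open>The summands of the defining identity\<close>

text \<open>
  The summand with inner operation \<open>m\<^sub>i\<close> starting at the \<open>l\<close>-th argument, kept apart from the double
  sum so that summands can be evaluated, or shown to vanish, one at a time.
\<close>

definition stasheff_term ::
  "('k::field \<Rightarrow> 'v \<Rightarrow> 'v::ab_group_add) \<Rightarrow> 'v bihom_ainf \<Rightarrow> int list \<Rightarrow> (int \<Rightarrow>\<^sub>0 'v) list
    \<Rightarrow> nat \<Rightarrow> nat \<Rightarrow> (int \<Rightarrow>\<^sub>0 'v)"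
  where "stasheff_term s X ps as i l =
    gscale s ((-1) powi (int (l * (i + 1)) + int i * sum_list (take (l - 1) ps)))
      (mult X (length as + 1 - i)
        (map (galpha X ^^ (i - 1)) (take (l - 1) as)
         @ [mult X i (take i (drop (l - 1) as))]
         @ map (gbeta X ^^ (i - 1)) (drop (l + i - 1) as)))"

definition stasheff_sum ::
  "('k::field \<Rightarrow> 'v \<Rightarrow> 'v::ab_group_add) \<Rightarrow> 'v bihom_ainf \<Rightarrow> int list \<Rightarrow> (int \<Rightarrow>\<^sub>0 'v) list \<Rightarrow> (int \<Rightarrow>\<^sub>0 'v)"
  where "stasheff_sum s X ps as =
    (\<Sum>i=1..length as. \<Sum>l=1..length as + 1 - i. stasheff_term s X ps as i l)"

text \<open>
  The arity is read off the argument list, which must therefore be nonempty.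
\<close>

lemma bihom_ainf_algebra_iff:
  "bihom_ainf_algebra s X \<longleftrightarrow>
    (let V = component X; A = total V; m = mult X; \<alpha> = galpha X; \<beta> = gbeta X; t = gscale s in
      (\<forall>p. module.subspace s (V p)) \<and>
      m \<in> extensional {1..} \<and>
      (\<forall>k\<ge>1. m k \<in> tuples k A \<rightarrow>\<^sub>E A \<and> multilinear_on t t k A A (m k) \<and>
        (\<forall>ps xs. length xs = k \<and> list_all2 (\<lambda>p x. x \<in> homog V p) ps xs
           \<longrightarrow> m k xs \<in> homog V (sum_list ps + int k - 2))) \<and>
      \<alpha> \<in> A \<rightarrow>\<^sub>E A \<and> linear_on t t A A \<alpha> \<and> (\<forall>p. \<alpha> \<in> homog V p \<rightarrow> homog V p) \<and>
      \<beta> \<in> A \<rightarrow>\<^sub>E A \<and> linear_on t t A A \<beta> \<and> (\<forall>p. \<beta> \<in> homog V p \<rightarrow> homog V p) \<and>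
      (\<forall>x\<in>A. \<alpha> (\<beta> x) = \<beta> (\<alpha> x)) \<and>
      (\<forall>k\<ge>1. \<forall>xs\<in>tuples k A. \<alpha> (m k xs) = m k (map \<alpha> xs) \<and> \<beta> (m k xs) = m k (map \<beta> xs)) \<and>
      (\<forall>ps as. as \<noteq> [] \<and> list_all2 (\<lambda>p a. a \<in> homog V p) ps as \<longrightarrow> stasheff_sum s X ps as = 0))"
  unfolding bihom_ainf_algebra_def Let_def stasheff_sum_def stasheff_term_def
  by (intro conj_cong refl) (auto simp: Suc_le_eq)

lemma minus_one_powi_even: "even n \<Longrightarrow> (-1 :: 'k::field) powi n = 1"
  by (elim evenE) (simp add: power_int_mult)

lemma sum_upto_numeral:
  fixes F :: "nat \<Rightarrow> 'a::comm_monoid_add"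
  shows "sum F {1..2} = F 1 + F 2" "sum F {1..3} = F 1 + F 2 + F 3"
    "sum F {1..4} = F 1 + F 2 + F 3 + F 4"
  by (simp_all add: eval_nat_numeral)

lemma funpow_2: "(F ^^ 2) x = F (F x)"
  by (simp add: eval_nat_numeral)

lemma hoch_coboundary_3:
  "hoch_coboundary s \<A> \<M> 3 \<theta> [a, b, c, d] =
    lact \<M> (alpha \<A> (alpha \<A> a)) (\<theta> [b, c, d])
    + (s (- 1) (\<theta> [amult \<A> a b, beta \<A> c, beta \<A> d]) + s 1 (\<theta> [alpha \<A> a, amult \<A> b c, beta \<A> d])
      + s (- 1) (\<theta> [alpha \<A> a, alpha \<A> b, amult \<A> c d]))
    + s 1 (ract \<M> (\<theta> [a, b, c]) (beta \<A> (beta \<A> d)))"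
  unfolding hoch_coboundary_def sum_upto_numeral by (simp add: funpow_2)

section \<open>The two-term algebra assembled from an algebra, a bimodule and a cochain\<close>

text \<open>
  This is the inverse of the correspondence. The degree-1 part of \<open>m\<^sub>2\<close> is the multiplication of a
  square-zero extension of the algebra by the bimodule. All operations are cut down to their domains,
  so that the result can be equal, and not just isomorphic, to a given algebra.
\<close>

definition skeletal_algebra ::
  "'v bihom_alg \<times> 'v bihom_bimod \<times> ('v list \<Rightarrow> 'v) \<Rightarrow> 'v::ab_group_add bihom_ainf"
  where "skeletal_algebra = (\<lambda>(\<A>, \<M>, \<theta>).
    let V = two_term_space (aspace \<A>) (mspace \<M>) in
    \<lparr>component = V,
     mult = (\<lambda>k\<in>{1..}. \<lambda>fs\<in>tuples k (total V).
       if k = 2 then pair_elt (amult \<A> (deg0 (fs ! 0)) (deg0 (fs ! 1)))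
         (lact \<M> (deg0 (fs ! 0)) (deg1 (fs ! 1)) + ract \<M> (deg1 (fs ! 0)) (deg0 (fs ! 1)))
       else if k = 3 then pair_elt 0 (\<theta> (map deg0 fs))
       else 0),
     galpha = (\<lambda>f\<in>total V. pair_elt (alpha \<A> (deg0 f)) (malpha \<M> (deg1 f))),
     gbeta = (\<lambda>f\<in>total V. pair_elt (beta \<A> (deg0 f)) (mbeta \<M> (deg1 f)))\<rparr>)"

text \<open>
  The underlying multilinear data of a cocycle tuple: domains, codomains and linearity, but none of the
  bihom axioms and no cocycle condition. Assembling the graded operations needs no more than this, so
  both directions of the correspondence can use the same computations.
\<close>

locale linear_data = vector_space scale
  for scale :: "'k::field \<Rightarrow> 'v::ab_group_add \<Rightarrow> 'v" +
  fixes \<A> :: "'v bihom_alg" and \<M> :: "'v bihom_bimod" and \<theta> :: "'v list \<Rightarrow> 'v"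
  assumes subspace_A: "subspace (aspace \<A>)"
    and subspace_M: "subspace (mspace \<M>)"
    and amult: "amult \<A> \<in> aspace \<A> \<rightarrow>\<^sub>E aspace \<A> \<rightarrow>\<^sub>E aspace \<A>"
      "bilinear_on scale (aspace \<A>) (aspace \<A>) (aspace \<A>) (amult \<A>)"
    and alpha: "alpha \<A> \<in> aspace \<A> \<rightarrow>\<^sub>E aspace \<A>"
      "linear_on scale scale (aspace \<A>) (aspace \<A>) (alpha \<A>)"
    and beta: "beta \<A> \<in> aspace \<A> \<rightarrow>\<^sub>E aspace \<A>"
      "linear_on scale scale (aspace \<A>) (aspace \<A>) (beta \<A>)"
    and lact: "lact \<M> \<in> aspace \<A> \<rightarrow>\<^sub>E mspace \<M> \<rightarrow>\<^sub>E mspace \<M>"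
      "bilinear_on scale (aspace \<A>) (mspace \<M>) (mspace \<M>) (lact \<M>)"
    and ract: "ract \<M> \<in> mspace \<M> \<rightarrow>\<^sub>E aspace \<A> \<rightarrow>\<^sub>E mspace \<M>"
      "bilinear_on scale (mspace \<M>) (aspace \<A>) (mspace \<M>) (ract \<M>)"
    and malpha: "malpha \<M> \<in> mspace \<M> \<rightarrow>\<^sub>E mspace \<M>"
      "linear_on scale scale (mspace \<M>) (mspace \<M>) (malpha \<M>)"
    and mbeta: "mbeta \<M> \<in> mspace \<M> \<rightarrow>\<^sub>E mspace \<M>"
      "linear_on scale scale (mspace \<M>) (mspace \<M>) (mbeta \<M>)"
    and cochain: "\<theta> \<in> tuples 3 (aspace \<A>) \<rightarrow>\<^sub>E mspace \<M>"
      "multilinear_on scale scale 3 (aspace \<A>) (mspace \<M>) \<theta>"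
begin

abbreviation "A \<equiv> aspace \<A>"
abbreviation "M \<equiv> mspace \<M>"
abbreviation "V \<equiv> two_term_space A M"
abbreviation "T \<equiv> total V"
abbreviation "X \<equiv> skeletal_algebra (\<A>, \<M>, \<theta>)"

lemmas gscale_simps [simp] = gscale_pair_elt[OF vector_space_axioms] gscale_0[OF vector_space_axioms]

lemma zero_closed [simp]: "0 \<in> A" "0 \<in> M"
  using subspace_A subspace_M by (simp_all add: subspace_0)

lemma space_closed [simp]:
  "a \<in> A \<Longrightarrow> b \<in> A \<Longrightarrow> a + b \<in> A" "a \<in> A \<Longrightarrow> scale c a \<in> A"
  "x \<in> M \<Longrightarrow> y \<in> M \<Longrightarrow> x + y \<in> M" "x \<in> M \<Longrightarrow> scale c x \<in> M"
  using subspace_A subspace_M by (simp_all add: subspace_add subspace_scale)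

lemmas bilinear_simps [simp] =
  bilinear_onD[OF amult(2)] bilinear_onD[OF lact(2)] bilinear_onD[OF ract(2)]
  bilinear_on_zero[OF amult(2)] bilinear_on_zero[OF lact(2)] bilinear_on_zero[OF ract(2)]

lemma linear_simps [simp]:
  "a \<in> A \<Longrightarrow> alpha \<A> a \<in> A" "a \<in> A \<Longrightarrow> beta \<A> a \<in> A"
  "x \<in> M \<Longrightarrow> malpha \<M> x \<in> M" "x \<in> M \<Longrightarrow> mbeta \<M> x \<in> M"
  "a \<in> A \<Longrightarrow> b \<in> A \<Longrightarrow> alpha \<A> (a + b) = alpha \<A> a + alpha \<A> b"
  "a \<in> A \<Longrightarrow> b \<in> A \<Longrightarrow> beta \<A> (a + b) = beta \<A> a + beta \<A> b"
  "x \<in> M \<Longrightarrow> y \<in> M \<Longrightarrow> malpha \<M> (x + y) = malpha \<M> x + malpha \<M> y"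
  "x \<in> M \<Longrightarrow> y \<in> M \<Longrightarrow> mbeta \<M> (x + y) = mbeta \<M> x + mbeta \<M> y"
  "a \<in> A \<Longrightarrow> alpha \<A> (scale c a) = scale c (alpha \<A> a)"
  "a \<in> A \<Longrightarrow> beta \<A> (scale c a) = scale c (beta \<A> a)"
  "x \<in> M \<Longrightarrow> malpha \<M> (scale c x) = scale c (malpha \<M> x)"
  "x \<in> M \<Longrightarrow> mbeta \<M> (scale c x) = scale c (mbeta \<M> x)"
  using alpha(2) beta(2) malpha(2) mbeta(2) by (auto simp: linear_on_def)

lemma linear_zero_simps [simp]: "alpha \<A> 0 = 0" "beta \<A> 0 = 0" "malpha \<M> 0 = 0" "mbeta \<M> 0 = 0"
  using linear_on_zero alpha(2) beta(2) malpha(2) mbeta(2) zero_closed by metis+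

lemma pair_elt_in_T [simp]: "pair_elt a x \<in> T \<longleftrightarrow> a \<in> A \<and> x \<in> M"
  by (auto simp: total_two_term_space)

lemma T_E: assumes "f \<in> T" obtains a x where "a \<in> A" "x \<in> M" "f = pair_elt a x"
  using assms by (auto simp: total_two_term_space)

lemma zero_in_T [simp]: "0 \<in> T"
  using pair_elt_in_T[of 0 0] by (simp del: pair_elt_in_T)

lemma component_X [simp]: "component X = V"
  by (simp add: skeletal_algebra_def Let_def)

lemma galpha_X [simp]: "a \<in> A \<Longrightarrow> x \<in> M \<Longrightarrow> galpha X (pair_elt a x) = pair_elt (alpha \<A> a) (malpha \<M> x)"
  and gbeta_X [simp]: "a \<in> A \<Longrightarrow> x \<in> M \<Longrightarrow> gbeta X (pair_elt a x) = pair_elt (beta \<A> a) (mbeta \<M> x)"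
  by (simp_all add: skeletal_algebra_def Let_def)

lemma galpha_X_closed [simp]: "f \<in> T \<Longrightarrow> galpha X f \<in> T"
  and gbeta_X_closed [simp]: "f \<in> T \<Longrightarrow> gbeta X f \<in> T"
  by (auto elim!: T_E)

lemma mult_2 [simp]:
  "\<lbrakk>a \<in> A; x \<in> M; b \<in> A; y \<in> M\<rbrakk> \<Longrightarrow> mult X 2 [pair_elt a x, pair_elt b y] =
    pair_elt (amult \<A> a b) (lact \<M> a y + ract \<M> x b)"
  by (simp add: skeletal_algebra_def Let_def tuples_def)

lemma mult_3: "fs \<in> tuples 3 T \<Longrightarrow> mult X 3 fs = pair_elt 0 (\<theta> (map deg0 fs))"
  by (simp add: skeletal_algebra_def Let_def)

lemma mult_other: "\<lbrakk>fs \<in> tuples k T; k \<ge> 1; k \<noteq> 2; k \<noteq> 3\<rbrakk> \<Longrightarrow> mult X k fs = 0"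
  by (simp add: skeletal_algebra_def Let_def)

lemma deg0_closed [simp]: "f \<in> T \<Longrightarrow> deg0 f \<in> A"
  by (auto elim!: T_E)

lemma map_deg0_tuples: "fs \<in> tuples n T \<Longrightarrow> map deg0 fs \<in> tuples n A"
  by (auto simp: tuples_def)

lemma cochain_closed [simp]: "as \<in> tuples 3 A \<Longrightarrow> \<theta> as \<in> M"
  using cochain(1) by auto

lemma tuples_2_E:
  assumes "fs \<in> tuples 2 T"
  obtains a x b y where "a \<in> A" "x \<in> M" "b \<in> A" "y \<in> M" "fs = [pair_elt a x, pair_elt b y]"
proof -
  obtain f g where "fs = [f, g]" "f \<in> T" "g \<in> T"
    using assms by (auto simp: tuples_def numeral_2_eq_2 length_Suc_conv)
  then show thesis using that by (metis T_E)
qed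

lemma mult_closed: assumes "fs \<in> tuples k T" "k \<ge> 1" shows "mult X k fs \<in> T"
proof -
  consider "k = 2" | "k = 3" | "k \<noteq> 2" "k \<noteq> 3" by blast
  then show ?thesis
  proof cases
    case 1 with assms show ?thesis by (auto elim!: tuples_2_E)
  next
    case 2 with assms show ?thesis by (simp add: mult_3 map_deg0_tuples)
  qed (use assms mult_other in simp)
qed

lemma mult_multilinear:
  assumes "k \<ge> 1" shows "multilinear_on (gscale scale) (gscale scale) k T T (mult X k)"
  unfolding multilinear_on_def
proof (intro conjI ballI allI impI)
  show "mult X k \<in> tuples k T \<rightarrow> T" using mult_closed assms by auto
  fix fs i assume fs: "fs \<in> tuples k T" and i: "i < k"
  have upd: "fs[i := f] \<in> tuples k T" if "f \<in> T" for f
    using tuples_update[OF fs that] .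
  consider "k = 2" | "k = 3" | "k \<noteq> 2" "k \<noteq> 3" by blast
  then show "linear_on (gscale scale) (gscale scale) T T (\<lambda>f. mult X k (fs[i := f]))"
  proof cases
    case 1
    then have "i = 0 \<or> i = 1" using i by auto
    with fs show ?thesis unfolding \<open>k = 2\<close>
      by (auto elim!: tuples_2_E T_E simp: linear_on_def algebra_simps scale_right_distrib)
  next
    case 2
    let ?as = "map deg0 fs"
    have "linear_on scale scale A M (\<lambda>a. \<theta> (?as[i := a]))"
      using cochain(2) map_deg0_tuples fs i 2 unfolding multilinear_on_def by blast
    moreover have "mult X k (fs[i := f]) = pair_elt 0 (\<theta> (?as[i := deg0 f]))" if "f \<in> T" for f
      using upd[OF that] 2 by (simp add: mult_3 map_update)
    ultimately show ?thesis
      by (auto elim!: T_E simp: linear_on_def Pi_iff)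
  next
    case 3
    then have "mult X k (fs[i := f]) = 0" if "f \<in> T" for f
      using upd[OF that] assms by (simp add: mult_other)
    then show ?thesis by (auto elim!: T_E simp: linear_on_def)
  qed
qed

lemma mult_zero: "\<lbrakk>fs \<in> tuples k T; k \<ge> 1; 0 \<in> set fs\<rbrakk> \<Longrightarrow> mult X k fs = 0"
  using multilinear_on_zero mult_multilinear by blast

lemma single_degree_cases:
  assumes "f \<in> homog V p"
  obtains a where "p = 0" "a \<in> A" "f = pair_elt a 0" | x where "p = 1" "x \<in> M" "f = pair_elt 0 x"
    | "p \<noteq> 0" "p \<noteq> 1" "f = 0"
  using assms by (auto simp: homog_two_term_space split: if_splits)

lemma homog_subset_T: "f \<in> homog V p \<Longrightarrow> f \<in> T"
  by (auto elim: single_degree_cases)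

lemma homog_list_tuples:
  "list_all2 (\<lambda>p f. f \<in> homog V p) ps fs \<Longrightarrow> fs \<in> tuples (length fs) T"
  using homog_subset_T by (fastforce simp: tuples_def list_all2_conv_all_nth in_set_conv_nth)

lemma zero_in_homog: "0 \<in> homog V p"
  by (auto simp: homog_two_term_space image_iff intro: exI[of _ 0] bexI[of _ 0])

text \<open>
  Only products of total degree at most 1 are nonzero: any argument of degree outside \<open>{0, 1}\<close> is
  zero, a binary product of two degree-1 elements has no component, and \<open>m\<^sub>3\<close> sees degree-0 parts only.
\<close>

lemma mult_degree:
  assumes "k \<ge> 1" "length xs = k" "list_all2 (\<lambda>p x. x \<in> homog V p) ps xs"
  shows "mult X k xs \<in> homog V (sum_list ps + int k - 2)"
proof -
  have xs: "xs \<in> tuples k T"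
    using homog_list_tuples[OF assms(3)] assms(2) by simp
  consider "0 \<in> set xs" | "k = 2" "0 \<notin> set xs" | "k = 3" "0 \<notin> set xs" | "k \<noteq> 2" "k \<noteq> 3" by blast
  then show ?thesis
  proof cases
    case 1 then show ?thesis using mult_zero[OF xs] assms zero_in_homog by simp
  next
    case 2
    then obtain f g p q where "xs = [f, g]" "ps = [p, q]" "f \<in> homog V p" "g \<in> homog V q"
      using assms by (auto simp: numeral_2_eq_2 length_Suc_conv list_all2_Cons2)
    moreover from this(3,4) have "mult X 2 [f, g] \<in> homog V (p + q)"
      using 2 calculation(1)
      by (elim single_degree_cases) (auto simp: homog_two_term_space)
    ultimately show ?thesis using 2 by simp
  next
    case 3
    then obtain f g h p q r where *: "xs = [f, g, h]" "ps = [p, q, r]"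
      "f \<in> homog V p" "g \<in> homog V q" "h \<in> homog V r"
      using assms by (auto simp: numeral_3_eq_3 length_Suc_conv list_all2_Cons2)
    have closed: "\<theta> (map deg0 xs) \<in> M" using map_deg0_tuples[OF xs] 3 by simp
    have "\<theta> (map deg0 xs) = 0" if "p \<noteq> 0 \<or> q \<noteq> 0 \<or> r \<noteq> 0"
      using that * map_deg0_tuples[OF xs] 3
      by (intro multilinear_on_zero[OF cochain(2)]) (auto elim!: single_degree_cases)
    then show ?thesis using * 3 xs closed zero_in_homog mult_3
      by (cases "p = 0 \<and> q = 0 \<and> r = 0") (auto simp: homog_two_term_space)
  next
    case 4 then show ?thesis using mult_other[OF xs] assms zero_in_homog by simp
  qed
qed

section \<open>The defining identity in arities three and four\<close>

lemma funpow_closed [simp]: "f \<in> T \<Longrightarrow> (galpha X ^^ n) f \<in> T" "f \<in> T \<Longrightarrow> (gbeta X ^^ n) f \<in> T"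
  by (induction n) auto

text \<open>
  If \<open>m\<^sub>i\<close> vanishes, the outer operation has a zero argument; if \<open>m\<^sub>j\<close> with \<open>j = n + 1 - i\<close> vanishes,
  there is nothing to show. That leaves \<open>i, j \<in> {2, 3}\<close>, and \<open>i = j = 3\<close> vanishes because values of
  \<open>m\<^sub>3\<close> have no degree-0 part, which is all that the outer \<open>m\<^sub>3\<close> uses.
\<close>

lemma stasheff_term_zero:
  assumes as: "as \<in> tuples n T" and i: "1 \<le> i" "i \<le> n" and l: "1 \<le> l" "l \<le> n + 1 - i"
    and ne: "\<not> (n = 3 \<and> i = 2)" "\<not> (n = 4 \<and> (i = 2 \<or> i = 3))"
  shows "stasheff_term scale X ps as i l = 0"
proof -
  define inner where "inner = take i (drop (l - 1) as)"
  define outer where "outer = map (galpha X ^^ (i - 1)) (take (l - 1) as) @ [mult X i inner]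
         @ map (gbeta X ^^ (i - 1)) (drop (l + i - 1) as)"
  have inner: "inner \<in> tuples i T"
    using as i l by (auto simp: tuples_def inner_def dest!: in_set_takeD in_set_dropD)
  have outer: "outer \<in> tuples (n + 1 - i) T"
    using as i l mult_closed[OF inner]
    by (auto simp: tuples_def outer_def dest!: in_set_takeD in_set_dropD)
  have "mult X (n + 1 - i) outer = 0"
  proof (cases "i = 2 \<or> i = 3")
    case False
    then have "mult X i inner = 0" using mult_other[OF inner] i by auto
    then show ?thesis using outer i by (intro mult_zero) (auto simp: outer_def)
  next
    case True
    show ?thesis
    proof (cases "n + 1 - i = 2 \<or> n + 1 - i = 3")
      case False
      then show ?thesis using outer i by (intro mult_other) auto
    next
      case True
      with \<open>i = 2 \<or> i = 3\<close> ne i have i3: "i = 3" "n + 1 - i = 3" by auto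
      then have "deg0 (mult X i inner) = 0" using inner by (simp add: mult_3)
      then have "0 \<in> set (map deg0 outer)" by (force simp: outer_def)
      then have "\<theta> (map deg0 outer) = 0"
        using multilinear_on_zero[OF cochain(2)] map_deg0_tuples[OF outer] i3 by auto
      then show ?thesis using outer i3 by (simp add: mult_3)
    qed
  qed
  moreover have "length as = n" using as by (simp add: tuples_def)
  ultimately show ?thesis
    by (simp add: stasheff_term_def inner_def outer_def)
qed

lemma stasheff_sum_zero:
  assumes "as \<in> tuples n T" "n \<noteq> 3" "n \<noteq> 4"
  shows "stasheff_sum scale X ps as = 0"
proof -
  have "length as = n" using assms by (simp add: tuples_def)
  then show ?thesis using assms
    unfolding stasheff_sum_def by (auto intro!: sum.neutral stasheff_term_zero)
qed

lemma minus_one_gscale: "gscale scale (- 1) f = - f"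
  by (rule poly_mapping_eqI) (simp add: gscale_lookup[OF vector_space_axioms])

lemma one_gscale: "gscale scale 1 f = f"
  by (rule poly_mapping_eqI) (simp add: gscale_lookup[OF vector_space_axioms])

text \<open>
  The two summands have the even \<open>i = 2\<close>, so that their signs do not depend on the degrees, and the
  formula holds for inhomogeneous arguments as well.
\<close>

lemma stasheff_sum_3:
  assumes "f \<in> T" "g \<in> T" "h \<in> T"
  shows "stasheff_sum scale X ps [f, g, h] =
    mult X 2 [galpha X f, mult X 2 [g, h]] - mult X 2 [mult X 2 [f, g], gbeta X h]"
proof -
  define as where "as = [f, g, h]"
  let ?t = "stasheff_term scale X ps as"
  have as: "as \<in> tuples 3 T" "length as = 3" using assms by (simp_all add: tuples_def as_def)
  have closed: "mult X 2 [f, g] \<in> T" if "f \<in> T" "g \<in> T" for f g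
    using that by (intro mult_closed) (simp_all add: tuples_def)
  have "stasheff_sum scale X ps as = ?t 2 1 + ?t 2 2"
    using stasheff_term_zero[OF as(1), of 1 _ ps] stasheff_term_zero[OF as(1), of 3 _ ps] as(2)
    by (simp add: stasheff_sum_def sum_upto_numeral del: One_nat_def)
  moreover have "?t 2 1 = - mult X 2 [mult X 2 [f, g], gbeta X h]"
    using assms
    by (simp add: stasheff_term_def as_def closed minus_one_gscale flip: numeral_2_eq_2)
  moreover have "?t 2 2 = mult X 2 [galpha X f, mult X 2 [g, h]]"
    using assms
    by (simp add: stasheff_term_def as_def closed one_gscale minus_one_powi_even flip: numeral_2_eq_2)
  ultimately show ?thesis by (simp add: as_def)
qed

text \<open>
  The summands with \<open>i = 2\<close> give the three inner terms of the coboundary and those with \<open>i = 3\<close> the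
  two outer ones. Only the last one, \<open>m\<^sub>2(\<alpha>\<^sup>2a\<^sub>1, m\<^sub>3(a\<^sub>2, a\<^sub>3, a\<^sub>4))\<close>, has a sign that involves a
  degree, which is where homogeneity enters.
\<close>

lemma stasheff_sum_4:
  assumes as: "list_all2 (\<lambda>p x. x \<in> homog V p) ps as" "length as = 4"
  shows "stasheff_sum scale X ps as = pair_elt 0 (hoch_coboundary scale \<A> \<M> 3 \<theta> (map deg0 as))"
proof -
  obtain p1 p2 p3 p4 f1 f2 f3 f4 where eq: "ps = [p1, p2, p3, p4]" "as = [f1, f2, f3, f4]"
    and f1: "f1 \<in> homog V p1" and f: "f1 \<in> T" "f2 \<in> T" "f3 \<in> T" "f4 \<in> T"
    using assms homog_subset_T by (auto simp: eval_nat_numeral length_Suc_conv list_all2_Cons2)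
  \<comment> \<open>The degree-1 parts \<open>x\<close> are carried along so that the values of the operations apply; they drop out.\<close>
  obtain a1 x1 where a1: "a1 \<in> A" "x1 \<in> M" "f1 = pair_elt a1 x1" using f(1) by (rule T_E)
  obtain a2 x2 where a2: "a2 \<in> A" "x2 \<in> M" "f2 = pair_elt a2 x2" using f(2) by (rule T_E)
  obtain a3 x3 where a3: "a3 \<in> A" "x3 \<in> M" "f3 = pair_elt a3 x3" using f(3) by (rule T_E)
  obtain a4 x4 where a4: "a4 \<in> A" "x4 \<in> M" "f4 = pair_elt a4 x4" using f(4) by (rule T_E)
  note a = a1(3) a2(3) a3(3) a4(3) and in_A = a1(1) a2(1) a3(1) a4(1) and in_M = a1(2) a2(2) a3(2) a4(2)
  have as: "as \<in> tuples 4 T" using f eq by (simp add: tuples_def)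
  have closed: "\<theta> [a, b, c] \<in> M" if "a \<in> A" "b \<in> A" "c \<in> A" for a b c
    using that by (simp add: tuples_def)
  have m3: "mult X 3 [pair_elt a x, pair_elt b y, pair_elt c z] = pair_elt 0 (\<theta> [a, b, c])"
    if "a \<in> A" "b \<in> A" "c \<in> A" "x \<in> M" "y \<in> M" "z \<in> M" for a b c x y z
    using that by (simp add: mult_3 tuples_def)
  let ?t = "stasheff_term scale X ps as"
  have "stasheff_sum scale X ps as = ?t 2 1 + ?t 2 2 + ?t 2 3 + (?t 3 1 + ?t 3 2)"
    using stasheff_term_zero[OF as, of 1 _ ps] stasheff_term_zero[OF as, of 4 _ ps] assms(2)
    by (simp add: stasheff_sum_def sum_upto_numeral del: One_nat_def)
  moreover have "?t 2 1 = pair_elt 0 (- \<theta> [amult \<A> a1 a2, beta \<A> a3, beta \<A> a4])"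
    using in_A in_M by (simp add: stasheff_term_def eq a m3 funpow_2 flip: numeral_2_eq_2)
  moreover have "?t 2 2 = pair_elt 0 (\<theta> [alpha \<A> a1, amult \<A> a2 a3, beta \<A> a4])"
    using in_A in_M by (simp add: stasheff_term_def eq a m3 funpow_2 minus_one_powi_even flip: numeral_2_eq_2)
  moreover have "?t 2 3 = pair_elt 0 (- \<theta> [alpha \<A> a1, alpha \<A> a2, amult \<A> a3 a4])"
    using in_A in_M by (simp add: stasheff_term_def eq a m3 funpow_2 flip: numeral_2_eq_2)
  moreover have "?t 3 1 = pair_elt 0 (ract \<M> (\<theta> [a1, a2, a3]) (beta \<A> (beta \<A> a4)))"
    using in_A in_M by (simp add: stasheff_term_def eq a m3 closed funpow_2 minus_one_powi_even flip: numeral_2_eq_2)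
  moreover have "?t 3 2 = pair_elt 0 (lact \<M> (alpha \<A> (alpha \<A> a1)) (\<theta> [a2, a3, a4]))"
  \<comment> \<open>The sign is \<open>(-1)\<^sup>3\<^sup>p\<close> with \<open>p\<close> the degree of the first argument; for \<open>p \<noteq> 0\<close> the term is zero.\<close>
  proof (cases "p1 = 0")
    case True
    then show ?thesis
      using in_A in_M by (simp add: stasheff_term_def eq a m3 closed funpow_2 minus_one_powi_even flip: numeral_2_eq_2)
  next
    case False
    with f1 a have "a1 = 0" by (auto elim: single_degree_cases simp flip: pair_elt_zero)
    then show ?thesis
      using in_A in_M by (simp add: stasheff_term_def eq a m3 closed funpow_2 flip: numeral_2_eq_2)
  qed
  ultimately show ?thesis
    by (simp add: hoch_coboundary_3 eq a)
qed

section \<open>Matching the axioms\<close>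

lemma ball_T: "(\<forall>f\<in>T. P f) \<longleftrightarrow> (\<forall>a\<in>A. \<forall>x\<in>M. P (pair_elt a x))"
  by (auto elim!: T_E)

text \<open>
  Both carriers contain zero, so a condition on the pair of components is the conjunction of the
  conditions on each of them.
\<close>

lemma commute_iff:
  "(\<forall>f\<in>T. galpha X (gbeta X f) = gbeta X (galpha X f)) \<longleftrightarrow>
    (\<forall>a\<in>A. alpha \<A> (beta \<A> a) = beta \<A> (alpha \<A> a)) \<and>
    (\<forall>x\<in>M. malpha \<M> (mbeta \<M> x) = mbeta \<M> (malpha \<M> x))"
proof -
  have "(\<forall>a\<in>A. \<forall>x\<in>M. P a \<and> Q x) \<longleftrightarrow> (\<forall>a\<in>A. P a) \<and> (\<forall>x\<in>M. Q x)" for P Q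
    using zero_closed by blast
  then show ?thesis unfolding ball_T by simp
qed

text \<open>
  Stated for an arbitrary degree-preserving pair of linear maps because it is applied to both structure
  maps. For the forward direction it is enough to evaluate at homogeneous arguments.
\<close>

lemma equivariant_iff:
  assumes p: "linear_on scale scale A A p" and q: "linear_on scale scale M M q"
    and g: "\<And>a x. a \<in> A \<Longrightarrow> x \<in> M \<Longrightarrow> g (pair_elt a x) = pair_elt (p a) (q x)"
  shows "(\<forall>k\<ge>1. \<forall>fs\<in>tuples k T. g (mult X k fs) = mult X k (map g fs)) \<longleftrightarrow>
    (\<forall>a\<in>A. \<forall>b\<in>A. p (amult \<A> a b) = amult \<A> (p a) (p b)) \<and>
    (\<forall>a\<in>A. \<forall>x\<in>M. q (lact \<M> a x) = lact \<M> (p a) (q x) \<and> q (ract \<M> x a) = ract \<M> (q x) (p a)) \<and>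
    (\<forall>as\<in>tuples 3 A. q (\<theta> as) = \<theta> (map p as))" (is "?L \<longleftrightarrow> ?R")
proof
  have pq [simp]: "a \<in> A \<Longrightarrow> p a \<in> A" "x \<in> M \<Longrightarrow> q x \<in> M" "p 0 = 0" "q 0 = 0"
    "x \<in> M \<Longrightarrow> y \<in> M \<Longrightarrow> q (x + y) = q x + q y" for a x y
    using p q linear_on_zero[OF p] linear_on_zero[OF q] by (auto simp: linear_on_def)
  note g [simp]
  {
    assume L: ?L
    have 2: "g (mult X 2 [f, h]) = mult X 2 [g f, g h]" if "f \<in> T" "h \<in> T" for f h
      using that L[rule_format, of 2 "[f, h]"] by (simp add: tuples_def)
    have "p (amult \<A> a b) = amult \<A> (p a) (p b)" if "a \<in> A" "b \<in> A" for a b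
      using that 2[of "pair_elt a 0" "pair_elt b 0"] by simp
    moreover have "q (lact \<M> a x) = lact \<M> (p a) (q x)" if "a \<in> A" "x \<in> M" for a x
      using that 2[of "pair_elt a 0" "pair_elt 0 x"] by simp
    moreover have "q (ract \<M> x a) = ract \<M> (q x) (p a)" if "a \<in> A" "x \<in> M" for a x
      using that 2[of "pair_elt 0 x" "pair_elt a 0"] by simp
    moreover have "q (\<theta> as) = \<theta> (map p as)" if as: "as \<in> tuples 3 A" for as
    proof -
      let ?fs = "map (\<lambda>a. pair_elt a 0) as"
      have fs: "?fs \<in> tuples 3 T" "map g ?fs \<in> tuples 3 T"
        using as by (auto simp: tuples_def)
      have "map deg0 (map g ?fs) = map p as" "map deg0 ?fs = as"
        using as by (auto simp: tuples_def intro!: map_idI)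
      then have "mult X 3 ?fs = pair_elt 0 (\<theta> as)" "mult X 3 (map g ?fs) = pair_elt 0 (\<theta> (map p as))"
        by (simp_all only: mult_3 fs)
      then show ?thesis using L[rule_format, OF _ fs(1)] as by simp
    qed
    ultimately show ?R by blast
  next
    assume R: ?R
    show ?L
    proof (intro allI impI ballI)
      fix k :: nat and fs assume k: "1 \<le> k" and fs: "fs \<in> tuples k T"
      have gfs: "map g fs \<in> tuples k T" using fs by (auto simp: tuples_def elim!: T_E dest!: subsetD)
      consider "k = 2" | "k = 3" | "k \<noteq> 2" "k \<noteq> 3" by blast
      then show "g (mult X k fs) = mult X k (map g fs)"
      proof cases
        case 1 then show ?thesis using fs R by (auto elim!: tuples_2_E)
      next
        case 2
        have "map deg0 (map g fs) = map p (map deg0 fs)"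
          using fs by (auto simp: tuples_def elim!: T_E dest!: subsetD)
        then have "mult X k fs = pair_elt 0 (\<theta> (map deg0 fs))"
          "mult X k (map g fs) = pair_elt 0 (\<theta> (map p (map deg0 fs)))"
          using fs gfs unfolding \<open>k = 3\<close> by (simp_all only: mult_3)
        then show ?thesis
          using R map_deg0_tuples[OF fs] unfolding \<open>k = 3\<close> by (simp del: map_map)
      next
        case 3 then show ?thesis
          using mult_other[OF fs k] mult_other[OF gfs k] g[of 0 0] by simp
      qed
    qed
  }
qed

lemma map_degree_zero:
  assumes "as \<in> tuples n A"
  shows "map deg0 (map (\<lambda>a. pair_elt a 0) as) = as"
    "list_all2 (\<lambda>p f. f \<in> homog V p) (replicate n 0) (map (\<lambda>a. pair_elt a 0) as)"
  using assms
  by (auto simp: tuples_def simp: list_all2_conv_all_nth homog_two_term_space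
      intro!: map_idI imageI nth_mem[THEN subsetD[rotated]])

lemma stasheff_iff:
  "(\<forall>ps fs. fs \<noteq> [] \<and> list_all2 (\<lambda>p f. f \<in> homog V p) ps fs \<longrightarrow> stasheff_sum scale X ps fs = 0) \<longleftrightarrow>
    (\<forall>a\<in>A. \<forall>b\<in>A. \<forall>c\<in>A. amult \<A> (alpha \<A> a) (amult \<A> b c) = amult \<A> (amult \<A> a b) (beta \<A> c)) \<and>
    (\<forall>a\<in>A. \<forall>b\<in>A. \<forall>x\<in>M.
        lact \<M> (alpha \<A> a) (lact \<M> b x) = lact \<M> (amult \<A> a b) (mbeta \<M> x) \<and>
        ract \<M> (malpha \<M> x) (amult \<A> a b) = ract \<M> (ract \<M> x a) (beta \<A> b) \<and>
        lact \<M> (alpha \<A> a) (ract \<M> x b) = ract \<M> (lact \<M> a x) (beta \<A> b)) \<and>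
    (\<forall>as\<in>tuples (3 + 1) A. hoch_coboundary scale \<A> \<M> 3 \<theta> as = 0)" (is "?L \<longleftrightarrow> ?R")
proof
  assume L: ?L
  have 3: "mult X 2 [galpha X f, mult X 2 [g, h]] = mult X 2 [mult X 2 [f, g], gbeta X h]"
    if "f \<in> homog V p" "g \<in> homog V q" "h \<in> homog V r" for f g h p q r
    using that L[rule_format, of "[f, g, h]" "[p, q, r]"] stasheff_sum_3[of f g h "[p, q, r]"] homog_subset_T
    by simp
  have deg: "a \<in> A \<Longrightarrow> pair_elt a 0 \<in> homog V 0" "x \<in> M \<Longrightarrow> pair_elt 0 x \<in> homog V 1" for a x
    by (auto simp: homog_two_term_space)
  have "amult \<A> (alpha \<A> a) (amult \<A> b c) = amult \<A> (amult \<A> a b) (beta \<A> c)"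
    if "a \<in> A" "b \<in> A" "c \<in> A" for a b c
    using that 3[of "pair_elt a 0" 0 "pair_elt b 0" 0 "pair_elt c 0" 0] by (simp add: deg)
  moreover have "lact \<M> (alpha \<A> a) (lact \<M> b x) = lact \<M> (amult \<A> a b) (mbeta \<M> x)"
    if "a \<in> A" "b \<in> A" "x \<in> M" for a b x
    using that 3[of "pair_elt a 0" 0 "pair_elt b 0" 0 "pair_elt 0 x" 1] by (simp add: deg)
  moreover have "ract \<M> (malpha \<M> x) (amult \<A> a b) = ract \<M> (ract \<M> x a) (beta \<A> b)"
    if "a \<in> A" "b \<in> A" "x \<in> M" for a b x
    using that 3[of "pair_elt 0 x" 1 "pair_elt a 0" 0 "pair_elt b 0" 0] by (simp add: deg)
  moreover have "lact \<M> (alpha \<A> a) (ract \<M> x b) = ract \<M> (lact \<M> a x) (beta \<A> b)"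
    if "a \<in> A" "b \<in> A" "x \<in> M" for a b x
    using that 3[of "pair_elt a 0" 0 "pair_elt 0 x" 1 "pair_elt b 0" 0] by (simp add: deg)
  moreover have "hoch_coboundary scale \<A> \<M> 3 \<theta> as = 0" if as: "as \<in> tuples (3 + 1) A" for as
  proof -
    let ?fs = "map (\<lambda>a. pair_elt a 0) as"
    have len: "length ?fs = 4" using as by (simp add: tuples_def)
    then have "?fs \<noteq> []" by (metis list.size(3) zero_neq_numeral)
    with L map_degree_zero(2)[OF as] have "stasheff_sum scale X (replicate (3 + 1) 0) ?fs = 0" by blast
    then show ?thesis
      using stasheff_sum_4[OF map_degree_zero(2)[OF as] len] map_degree_zero(1)[OF as]
      by (metis pair_elt_inject pair_elt_zero)
  qed
  ultimately show ?R by blast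
next
  assume R: ?R
  show ?L
  proof (intro allI impI, elim conjE)
    fix ps fs assume fs: "fs \<noteq> []" "list_all2 (\<lambda>p f. f \<in> homog V p) ps fs"
    note tup = homog_list_tuples[OF fs(2)]
    consider "length fs = 3" | "length fs = 4" | "length fs \<noteq> 3" "length fs \<noteq> 4" by blast
    then show "stasheff_sum scale X ps fs = 0"
    proof cases
      case 1
      then obtain f g h where "fs = [f, g, h]" "f \<in> T" "g \<in> T" "h \<in> T"
        using tup by (auto simp: tuples_def numeral_3_eq_3 length_Suc_conv)
      then show ?thesis using R
        by (auto elim!: T_E simp: stasheff_sum_3)
    next
      case 2
      then show ?thesis
        using stasheff_sum_4[OF fs(2) 2] R map_deg0_tuples[OF tup] by simp
    qed (use stasheff_sum_zero[OF tup] in simp)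
  qed
qed

lemma mult_X_extensional: "mult X \<in> extensional {1..}" "k \<ge> 1 \<Longrightarrow> mult X k \<in> tuples k T \<rightarrow>\<^sub>E T"
  using mult_closed by (auto simp: skeletal_algebra_def Let_def PiE_iff)

lemma galpha_X_linear:
  "galpha X \<in> T \<rightarrow>\<^sub>E T" "linear_on (gscale scale) (gscale scale) T T (galpha X)"
  "galpha X \<in> homog V p \<rightarrow> homog V p"
proof -
  show "galpha X \<in> T \<rightarrow>\<^sub>E T"
    using galpha_X_closed by (simp add: skeletal_algebra_def Let_def PiE_iff)
  show "linear_on (gscale scale) (gscale scale) T T (galpha X)"
    by (auto simp: linear_on_def elim!: T_E)
  show "galpha X \<in> homog V p \<rightarrow> homog V p"
    using galpha_X[of 0 0] by (auto simp: homog_two_term_space)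
qed

lemma gbeta_X_linear:
  "gbeta X \<in> T \<rightarrow>\<^sub>E T" "linear_on (gscale scale) (gscale scale) T T (gbeta X)"
  "gbeta X \<in> homog V p \<rightarrow> homog V p"
proof -
  show "gbeta X \<in> T \<rightarrow>\<^sub>E T"
    using gbeta_X_closed by (simp add: skeletal_algebra_def Let_def PiE_iff)
  show "linear_on (gscale scale) (gscale scale) T T (gbeta X)"
    by (auto simp: linear_on_def elim!: T_E)
  show "gbeta X \<in> homog V p \<rightarrow> homog V p"
    using gbeta_X[of 0 0] by (auto simp: homog_two_term_space)
qed

lemma subspace_V: "subspace (V p)"
  using subspace_A subspace_M by (simp add: two_term_space_def)

text \<open>
  The clauses on domains, linearity and degrees hold for all linear data; what remains on either side is
  the same list of equations in a different order.
\<close>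

lemma skeletal_algebra_mem_iff:
  "X \<in> skeletal_two_term_algebras scale \<longleftrightarrow> (\<A>, \<M>, \<theta>) \<in> three_cocycle_tuples scale"
proof -
  have equivariant:
    "(\<forall>k\<ge>1. \<forall>fs\<in>tuples k T. galpha X (mult X k fs) = mult X k (map (galpha X) fs)) \<longleftrightarrow>
      (\<forall>a\<in>A. \<forall>b\<in>A. alpha \<A> (amult \<A> a b) = amult \<A> (alpha \<A> a) (alpha \<A> b)) \<and>
      (\<forall>a\<in>A. \<forall>x\<in>M. malpha \<M> (lact \<M> a x) = lact \<M> (alpha \<A> a) (malpha \<M> x) \<and>
        malpha \<M> (ract \<M> x a) = ract \<M> (malpha \<M> x) (alpha \<A> a)) \<and>
      (\<forall>as\<in>tuples 3 A. malpha \<M> (\<theta> as) = \<theta> (map (alpha \<A>) as))"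
    "(\<forall>k\<ge>1. \<forall>fs\<in>tuples k T. gbeta X (mult X k fs) = mult X k (map (gbeta X) fs)) \<longleftrightarrow>
      (\<forall>a\<in>A. \<forall>b\<in>A. beta \<A> (amult \<A> a b) = amult \<A> (beta \<A> a) (beta \<A> b)) \<and>
      (\<forall>a\<in>A. \<forall>x\<in>M. mbeta \<M> (lact \<M> a x) = lact \<M> (beta \<A> a) (mbeta \<M> x) \<and>
        mbeta \<M> (ract \<M> x a) = ract \<M> (mbeta \<M> x) (beta \<A> a)) \<and>
      (\<forall>as\<in>tuples 3 A. mbeta \<M> (\<theta> as) = \<theta> (map (beta \<A>) as))"
    by (rule equivariant_iff; simp add: alpha malpha beta mbeta)+
  have "two_term X" "skeletal X"
    using mult_other[of _ 1] by (auto simp: two_term_def skeletal_def two_term_space_def tuples_def homog_subset_T)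
  moreover have graded: "\<forall>k\<ge>1. mult X k \<in> tuples k T \<rightarrow>\<^sub>E T"
    "\<forall>k\<ge>1. multilinear_on (gscale scale) (gscale scale) k T T (mult X k)"
    "\<forall>k\<ge>1. \<forall>ps xs. length xs = k \<and> list_all2 (\<lambda>p x. x \<in> homog V p) ps xs \<longrightarrow>
       mult X k xs \<in> homog V (sum_list ps + int k - 2)"
    using mult_X_extensional(2) mult_multilinear mult_degree by blast+
  ultimately have "X \<in> skeletal_two_term_algebras scale \<longleftrightarrow>
    (\<forall>f\<in>T. galpha X (gbeta X f) = gbeta X (galpha X f)) \<and>
    (\<forall>k\<ge>1. \<forall>fs\<in>tuples k T. galpha X (mult X k fs) = mult X k (map (galpha X) fs)) \<and>
    (\<forall>k\<ge>1. \<forall>fs\<in>tuples k T. gbeta X (mult X k fs) = mult X k (map (gbeta X) fs)) \<and>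
    (\<forall>ps fs. fs \<noteq> [] \<and> list_all2 (\<lambda>p f. f \<in> homog V p) ps fs \<longrightarrow> stasheff_sum scale X ps fs = 0)"
    using subspace_V mult_X_extensional(1) graded galpha_X_linear gbeta_X_linear
    by (simp only: skeletal_two_term_algebras_def mem_Collect_eq bihom_ainf_algebra_iff component_X Let_def
      ball_conj_distrib all_conj_distrib imp_conjR simp_thms) (intro iffI; elim conjE; intro conjI; assumption)
  also have "\<dots> \<longleftrightarrow> (\<A>, \<M>, \<theta>) \<in> three_cocycle_tuples scale"
    unfolding commute_iff equivariant stasheff_iff
      three_cocycle_tuples_def bihom_associative_def bihom_bimodule_def hoch_cocycle_def hoch_cochain_def
      Let_def mem_Collect_eq prod.case
    by (simp only: subspace_A subspace_M amult alpha beta lact ract malpha mbeta cochain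
      ball_conj_distrib simp_thms conj_ac)
  finally show ?thesis .
qed

lemma to_cocycle_tuple_skeletal_algebra: "to_cocycle_tuple X = (\<A>, \<M>, \<theta>)"
proof -
  have V: "V 0 = A" "V 1 = M" by (simp_all add: two_term_space_def)
  have PiE2: "(\<lambda>a\<in>B. \<lambda>b\<in>C. h a b) = f"
    if "f \<in> B \<rightarrow>\<^sub>E C \<rightarrow>\<^sub>E D" "\<And>a b. a \<in> B \<Longrightarrow> b \<in> C \<Longrightarrow> h a b = f a b"
    for B C D :: "'v set" and f h :: "'v \<Rightarrow> 'v \<Rightarrow> 'v"
  proof (intro ext)
    show "(\<lambda>a\<in>B. \<lambda>b\<in>C. h a b) a b = f a b" for a b
      using that by (cases "a \<in> B"; cases "b \<in> C") (auto simp: PiE_iff extensional_def)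
  qed
  have PiE1: "(\<lambda>a\<in>B. h a) = f" if "f \<in> B \<rightarrow>\<^sub>E C" "\<And>a. a \<in> B \<Longrightarrow> h a = f a"
    for B :: "'b set" and C :: "'v set" and f h
    using that by (intro ext) (auto simp: PiE_iff extensional_def restrict_def)
  have "degree_zero_algebra X = \<A>"
    unfolding degree_zero_algebra_def Let_def component_X V single_0_eq_pair_elt
    using amult(1) alpha(1) beta(1)
    by (intro bihom_alg.equality) (auto intro!: PiE2 PiE1)
  moreover have "degree_one_bimodule X = \<M>"
    unfolding degree_one_bimodule_def Let_def component_X V single_0_eq_pair_elt single_1_eq_pair_elt
    using lact(1) ract(1) malpha(1) mbeta(1)
    by (intro bihom_bimod.equality) (auto intro!: PiE2 PiE1)
  moreover have "ternary_cochain X = \<theta>"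
    unfolding ternary_cochain_def component_X V single_0_eq_pair_elt
  proof (rule PiE1[OF cochain(1)])
    fix as assume as: "as \<in> tuples 3 A"
    then have "map (\<lambda>a. pair_elt a 0) as \<in> tuples 3 T" by (auto simp: tuples_def)
    then show "deg1 (mult X 3 (map (\<lambda>a. pair_elt a 0) as)) = \<theta> as"
      by (simp only: mult_3 map_degree_zero(1)[OF as]) simp
  qed
  ultimately show ?thesis by (simp add: to_cocycle_tuple_def)
qed

end

lemma linear_data_of_cocycle_tuple:
  assumes "vector_space s" "(\<A>, \<M>, \<theta>) \<in> three_cocycle_tuples s"
  shows "linear_data s \<A> \<M> \<theta>"
  using assms unfolding linear_data_def linear_data_axioms_def
    three_cocycle_tuples_def bihom_associative_def bihom_bimodule_def hoch_cocycle_def hoch_cochain_def Let_def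
  by simp

section \<open>A skeletal two-term algebra is determined by its components\<close>

locale skeletal_two_term = vector_space scale
  for scale :: "'k::field \<Rightarrow> 'v::ab_group_add \<Rightarrow> 'v" +
  fixes Y :: "'v bihom_ainf"
  assumes Y: "Y \<in> skeletal_two_term_algebras scale"
begin

abbreviation "V \<equiv> component Y"
abbreviation "T \<equiv> total V"

text \<open>
  The parts of the definition that describe the shape of the operations; the equational axioms are left
  to \<open>skeletal_algebra_mem_iff\<close>.
\<close>

lemma ainf_structure:
  "\<forall>p. subspace (V p)" "mult Y \<in> extensional {1..}"
  "\<forall>k\<ge>1. mult Y k \<in> tuples k T \<rightarrow>\<^sub>E T \<and> multilinear_on (gscale scale) (gscale scale) k T T (mult Y k) \<and>
    (\<forall>ps xs. length xs = k \<and> list_all2 (\<lambda>p x. x \<in> homog V p) ps xs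
      \<longrightarrow> mult Y k xs \<in> homog V (sum_list ps + int k - 2))"
  "galpha Y \<in> T \<rightarrow>\<^sub>E T" "linear_on (gscale scale) (gscale scale) T T (galpha Y)"
  "\<forall>p. galpha Y \<in> homog V p \<rightarrow> homog V p"
  "gbeta Y \<in> T \<rightarrow>\<^sub>E T" "linear_on (gscale scale) (gscale scale) T T (gbeta Y)"
  "\<forall>p. gbeta Y \<in> homog V p \<rightarrow> homog V p"
  "\<forall>p. p \<noteq> 0 \<and> p \<noteq> 1 \<longrightarrow> V p = {0}"
  "\<forall>x\<in>homog V 1. mult Y 1 [x] = 0"
  using Y unfolding skeletal_two_term_algebras_def bihom_ainf_algebra_iff two_term_def skeletal_def Let_def
    mem_Collect_eq
  by - (elim conjE; assumption)+

lemma subspace_component: "subspace (V p)" and concentrated: "p \<noteq> 0 \<Longrightarrow> p \<noteq> 1 \<Longrightarrow> V p = {0}"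
  using ainf_structure(1,10) by auto

lemma mult_structure:
  assumes "k \<ge> 1"
  shows "mult Y k \<in> tuples k T \<rightarrow>\<^sub>E T" "multilinear_on (gscale scale) (gscale scale) k T T (mult Y k)"
    "length xs = k \<Longrightarrow> list_all2 (\<lambda>p x. x \<in> homog V p) ps xs
      \<Longrightarrow> mult Y k xs \<in> homog V (sum_list ps + int k - 2)"
  using ainf_structure(3)[rule_format, OF assms] by auto

lemma V_eq: "two_term_space (V 0) (V 1) = V"
  using concentrated by (intro ext) (auto simp: two_term_space_def)

lemma T_cases:
  assumes "f \<in> T"
  obtains a x where "a \<in> V 0" "x \<in> V 1" "f = pair_elt a x"
  using assms total_two_term_space[of "V 0" "V 1"] unfolding V_eq by blast

lemma zero_V: "0 \<in> V p"
  using subspace_component by (rule subspace_0)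

lemma zero_T: "0 \<in> T"
  using zero_V by (simp add: total_def)

lemma single_in_T: "x \<in> V p \<Longrightarrow> Poly_Mapping.single p x \<in> T"
  using zero_V by (auto simp: total_def lookup_single when_def)

lemma component_linear:
  assumes "linear_on (gscale scale) (gscale scale) T T F"
  shows "linear_on scale scale (V p) (V q) (\<lambda>x. Poly_Mapping.lookup (F (Poly_Mapping.single p x)) q)"
  using linear_on_comp[OF linear_on_comp[OF linear_on_single[OF vector_space_axioms] assms]
      linear_on_lookup[OF vector_space_axioms]] zero_V by blast

lemma component_multilinear:
  assumes "k \<ge> 1" "fs \<in> tuples k T" "i < k"
  shows "linear_on scale scale (V p) (V q)
    (\<lambda>x. Poly_Mapping.lookup (mult Y k (fs[i := Poly_Mapping.single p x])) q)"
proof -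
  have "linear_on (gscale scale) (gscale scale) T T (\<lambda>f. mult Y k (fs[i := f]))"
    using mult_structure(2)[OF assms(1)] assms by (auto simp: multilinear_on_def)
  from component_linear[OF this] show ?thesis .
qed

lemma linear_on_restrict:
  assumes "linear_on scale scale (V p) W f"
  shows "linear_on scale scale (V p) W (restrict f (V p))"
  by (rule linear_on_cong[OF assms _ subspace_component module_axioms]) simp

text \<open>
  With \<open>(p, q, r)\<close> equal to \<open>(0, 0, 0)\<close>, \<open>(0, 1, 1)\<close> and \<open>(1, 0, 1)\<close> this yields the product and the
  left and right actions.
\<close>

lemma component_mult_2:
  fixes p q r :: int
  defines "F \<equiv> \<lambda>x\<in>V p. \<lambda>y\<in>V q. Poly_Mapping.lookup (mult Y 2 [Poly_Mapping.single p x, Poly_Mapping.single q y]) r"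
  shows "F \<in> V p \<rightarrow>\<^sub>E V q \<rightarrow>\<^sub>E V r" "bilinear_on scale (V p) (V q) (V r) F"
proof -
  have 1: "linear_on scale scale (V q) (V r) (F x)" if "x \<in> V p" for x
    using component_multilinear[of 2 "[Poly_Mapping.single p x, 0]" 1 q r] that
    by (simp add: F_def tuples_def single_in_T zero_T linear_on_restrict)
  have 2: "linear_on scale scale (V p) (V r) (\<lambda>x. F x y)" if y: "y \<in> V q" for y
  proof -
    have "linear_on scale scale (V p) (V r)
      (\<lambda>x. Poly_Mapping.lookup (mult Y 2 [Poly_Mapping.single p x, Poly_Mapping.single q y]) r)"
      using component_multilinear[of 2 "[0, Poly_Mapping.single q y]" 0 p r] y
      by (simp add: tuples_def single_in_T zero_T)
    then show ?thesis
      by (rule linear_on_cong) (use y subspace_component module_axioms in \<open>auto simp: F_def\<close>)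
  qed
  show "bilinear_on scale (V p) (V q) (V r) F"
    using 1 2 by (simp add: bilinear_on_def)
  then show "F \<in> V p \<rightarrow>\<^sub>E V q \<rightarrow>\<^sub>E V r"
    by (auto simp: PiE_iff F_def bilinear_on_def linear_on_def extensional_def Pi_iff)
qed

lemma component_map:
  fixes p :: int
  assumes "linear_on (gscale scale) (gscale scale) T T G"
  defines "F \<equiv> \<lambda>x\<in>V p. Poly_Mapping.lookup (G (Poly_Mapping.single p x)) p"
  shows "F \<in> V p \<rightarrow>\<^sub>E V p" "linear_on scale scale (V p) (V p) F"
proof -
  show "linear_on scale scale (V p) (V p) F"
    unfolding F_def using component_linear[OF assms(1)] by (rule linear_on_restrict)
  then have "F \<in> V p \<rightarrow> V p" by (simp add: linear_on_def)
  moreover have "F \<in> extensional (V p)" by (simp add: F_def)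
  ultimately show "F \<in> V p \<rightarrow>\<^sub>E V p" by (simp add: PiE_def)
qed

lemma component_mult_3:
  "ternary_cochain Y \<in> tuples 3 (V 0) \<rightarrow>\<^sub>E V 1"
  "multilinear_on scale scale 3 (V 0) (V 1) (ternary_cochain Y)"
proof -
  have tup: "map (Poly_Mapping.single 0) as \<in> tuples 3 T" if "as \<in> tuples 3 (V 0)" for as
    using that by (auto simp: tuples_def single_in_T)
  have closed: "ternary_cochain Y as \<in> V 1" if "as \<in> tuples 3 (V 0)" for as
    using that mult_structure(1)[of 3] tup by (auto simp: ternary_cochain_def total_def PiE_iff)
  then show "ternary_cochain Y \<in> tuples 3 (V 0) \<rightarrow>\<^sub>E V 1"
    by (auto simp: PiE_iff ternary_cochain_def)
  show "multilinear_on scale scale 3 (V 0) (V 1) (ternary_cochain Y)"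
    unfolding multilinear_on_def
  proof (intro conjI ballI allI impI)
    show "ternary_cochain Y \<in> tuples 3 (V 0) \<rightarrow> V 1" using closed by blast
    fix as and i :: nat assume as: "as \<in> tuples 3 (V 0)" and i: "i < 3"
    from component_multilinear[OF _ tup[OF as] i, of 0 1]
    show "linear_on scale scale (V 0) (V 1) (\<lambda>x. ternary_cochain Y (as[i := x]))"
      by (rule linear_on_cong)
        (use tuples_update[OF as] subspace_component module_axioms in \<open>auto simp: ternary_cochain_def map_update\<close>)
  qed
qed

lemma linear_data_Y:
  "linear_data scale (degree_zero_algebra Y) (degree_one_bimodule Y) (ternary_cochain Y)"
  unfolding linear_data_def linear_data_axioms_def degree_zero_algebra_def degree_one_bimodule_def Let_def
  using vector_space_axioms subspace_component component_mult_2 component_map[OF ainf_structure(5)]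
    component_map[OF ainf_structure(8)] component_mult_3
  by simp

text \<open>
  By multilinearity it suffices to compare the operations on homogeneous arguments of degrees 0 and 1.
  There both sides lie in degree \<open>d\<close>, the sum of the degrees plus \<open>k - 2\<close>, and so vanish unless
  \<open>d \<in> {0, 1}\<close>. This leaves \<open>m\<^sub>1\<close> on degree 1, which is zero as the algebra is skeletal, and the
  components from which the tuple was read off.
\<close>

lemma skeletal_algebra_to_cocycle_tuple: "skeletal_algebra (to_cocycle_tuple Y) = Y"
proof -
  interpret L: linear_data scale "degree_zero_algebra Y" "degree_one_bimodule Y" "ternary_cochain Y"
    by (rule linear_data_Y)
  define X where "X = skeletal_algebra (to_cocycle_tuple Y)"
  have X: "X = L.X" by (simp add: X_def to_cocycle_tuple_def)
  have carriers: "L.A = V 0" "L.M = V 1"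
    by (simp_all add: degree_zero_algebra_def degree_one_bimodule_def Let_def)
  have LV: "L.V = V" by (simp add: carriers V_eq)
  have decomp: "\<exists>y\<in>homog V 0 \<union> homog V 1. \<exists>z\<in>homog V 0 \<union> homog V 1. f = y + z" if "f \<in> T" for f
  proof -
    obtain a x where "a \<in> V 0" "x \<in> V 1" "f = pair_elt a x"
      using \<open>f \<in> T\<close> by (rule T_cases)
    then have "Poly_Mapping.single 0 a \<in> homog V 0" "Poly_Mapping.single 1 x \<in> homog V 1"
      "f = Poly_Mapping.single 0 a + Poly_Mapping.single 1 x"
      by (simp_all add: homog_def pair_elt_def)
    then show ?thesis by blast
  qed
  have homog_T: "homog V p \<subseteq> T" for p
    by (auto simp: homog_def single_in_T)
  have mult_homog: "mult Y k fs = mult X k fs"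
    if k: "k \<ge> 1" and fs: "fs \<in> tuples k (homog V 0 \<union> homog V 1)" for k fs
  proof -
    \<comment> \<open>A degree for each entry; zero entries lie in both components and are given degree 0.\<close>
    define ps where "ps = map (\<lambda>f. if f \<in> homog V 0 then 0 else 1 :: int) fs"
    have ps: "list_all2 (\<lambda>p f. f \<in> homog V p) ps fs" and len: "length fs = k"
      using fs by (auto simp: ps_def tuples_def list_all2_map1 list_all2_same)
    have "set ps \<subseteq> {0, 1}" by (auto simp: ps_def)
    have fsT: "fs \<in> tuples k T" using fs homog_T by (force simp: tuples_def)
    let ?d = "sum_list ps + int k - 2"
    have Yd: "mult Y k fs \<in> homog V ?d" and Xd: "mult X k fs \<in> homog V ?d"
      using mult_structure(3)[OF k len ps] L.mult_degree[OF k len] ps by (simp_all add: X LV)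
    show ?thesis
    proof (cases "?d = 0 \<or> ?d = 1")
      case False
      then have "V ?d = {0}" by (intro concentrated) auto
      then have "homog V ?d = {0}" by (simp add: homog_def)
      with Xd Yd have "mult Y k fs = 0" "mult X k fs = 0" by simp_all
      then show ?thesis by simp
    next
      case True
      have "0 \<le> sum_list ps" using \<open>set ps \<subseteq> {0, 1}\<close> by (intro sum_list_nonneg) auto
      \<comment> \<open>The degrees sum to \<open>2 - k\<close> or \<open>3 - k\<close>, and the sum is nonnegative.\<close>
      with True k consider "k = 1" | "k = 2" | "k = 3" by linarith
      then show ?thesis
      proof cases
        case 1
        then obtain f p where fp: "fs = [f]" "ps = [p]" "f \<in> homog V p"
          using ps len by (auto simp: length_Suc_conv list_all2_Cons2)
        with True 1 \<open>set ps \<subseteq> {0, 1}\<close> have "p = 1" by auto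
        then have "mult Y 1 fs = 0" using ainf_structure(11) fp by simp
        moreover have "mult X 1 fs = 0" using L.mult_other[of fs 1] fsT 1 by (simp add: X LV)
        ultimately show ?thesis using 1 by simp
      next
        case 2
        then obtain f g p q where fs2: "fs = [f, g]" and ps2: "ps = [p, q]"
          and fg: "f \<in> homog V p" "g \<in> homog V q"
          using ps len by (auto simp: numeral_2_eq_2 length_Suc_conv list_all2_Cons2)
        obtain a b where a: "a \<in> V p" "f = Poly_Mapping.single p a"
          and b: "b \<in> V q" "g = Poly_Mapping.single q b"
          using fg by (auto simp: homog_def)
        have Y2: "mult Y 2 fs = Poly_Mapping.single (p + q) (Poly_Mapping.lookup (mult Y 2 fs) (p + q))"
          using Yd 2 ps2 by (intro homog_eq_single[of _ V]) simp
        have *: "lact (degree_one_bimodule Y) c 0 = 0" "ract (degree_one_bimodule Y) 0 c = 0"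
          "amult (degree_zero_algebra Y) c 0 = 0" "amult (degree_zero_algebra Y) 0 c = 0" if "c \<in> V 0" for c
          using that L.zero_closed by (simp_all add: carriers L.bilinear_simps flip: carriers)
        have "p = 0 \<and> q = 0 \<or> p = 0 \<and> q = 1 \<or> p = 1 \<and> q = 0"
          using True 2 ps2 \<open>set ps \<subseteq> {0, 1}\<close> by auto
        then show ?thesis
        proof (elim disjE conjE)
          assume pq: "p = 0" "q = 0"
          then show ?thesis using a b Y2 2 fs2 L.mult_2[of a 0 b 0] L.zero_closed *
            by (simp add: X carriers single_0_eq_pair_elt)
              (simp add: degree_zero_algebra_def Let_def single_0_eq_pair_elt)
        next
          assume pq: "p = 0" "q = 1"
          then show ?thesis using a b Y2 2 fs2 L.mult_2[of a 0 0 b] L.zero_closed *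
            by (simp add: X carriers single_0_eq_pair_elt single_1_eq_pair_elt)
              (simp add: degree_one_bimodule_def Let_def single_0_eq_pair_elt single_1_eq_pair_elt)
        next
          assume pq: "p = 1" "q = 0"
          then show ?thesis using a b Y2 2 fs2 L.mult_2[of 0 a b 0] L.zero_closed *
            by (simp add: X carriers single_0_eq_pair_elt single_1_eq_pair_elt)
              (simp add: degree_one_bimodule_def Let_def single_0_eq_pair_elt single_1_eq_pair_elt)
        qed
      next
        case 3
        have "sum_list ps = 0" using True 3 \<open>0 \<le> sum_list ps\<close> by linarith
        then have "\<forall>p\<in>set ps. p = 0"
          using \<open>set ps \<subseteq> {0, 1}\<close> sum_list_nonneg_eq_0_iff[of ps] by fastforce
        then have "f \<in> homog V 0" if "f \<in> set fs" for f
          using ps that by (metis in_set_conv_nth list_all2_conv_all_nth nth_mem)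
        then have "Poly_Mapping.single 0 (deg0 f) = f \<and> deg0 f \<in> V 0" if "f \<in> set fs" for f
          using that by (force simp: homog_def)
        then have fs0: "fs = map (Poly_Mapping.single 0) (map deg0 fs)" and as: "map deg0 fs \<in> tuples 3 (V 0)"
          using len 3 by (auto simp: tuples_def intro!: map_idI[symmetric])
        have "mult Y 3 fs = Poly_Mapping.single 1 (deg1 (mult Y 3 fs))"
          using Yd 3 \<open>sum_list ps = 0\<close> by (intro homog_eq_single[of _ V]) simp
        also have "deg1 (mult Y 3 fs) = ternary_cochain Y (map deg0 fs)"
          using as by (simp only: ternary_cochain_def restrict_apply if_True fs0[symmetric])
        also have "Poly_Mapping.single 1 \<dots> = mult X 3 fs"
          using L.mult_3[of fs] fsT 3 by (simp add: X LV single_1_eq_pair_elt)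
        finally show ?thesis using 3 by simp
      qed
    qed
  qed
  have mult_eq: "mult Y k = mult X k" for k
  proof (cases "k \<ge> 1")
    case False
    then show ?thesis using ainf_structure(2) L.mult_X_extensional(1) by (simp add: X extensional_def)
  next
    case True
    show ?thesis
    proof
      fix fs
      show "mult Y k fs = mult X k fs"
      proof (cases "fs \<in> tuples k T")
        case False
        then show ?thesis
          using mult_structure(1)[OF True] L.mult_X_extensional(2)[OF True] by (auto simp: X LV PiE_iff extensional_def)
      next
        case fs: True
        have "multilinear_on (gscale scale) (gscale scale) k T T (mult X k)"
          using L.mult_multilinear[OF True] by (simp add: X LV)
        from multilinear_on_eqI[OF mult_structure(2)[OF True] this decomp _ mult_homog[OF True] fs]
        show ?thesis using homog_T by blast
      qed
    qed
  qed
  \<comment> \<open>A degree-preserving linear map is determined by its two diagonal components.\<close>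
  have diagonal: "G f = pair_elt (deg0 (G (Poly_Mapping.single 0 a))) (deg1 (G (Poly_Mapping.single 1 x)))"
    if "linear_on (gscale scale) (gscale scale) T T G" "\<forall>p. G \<in> homog V p \<rightarrow> homog V p"
      and "a \<in> V 0" "x \<in> V 1" and "f = pair_elt a x" for G f a x
  proof -
    have deg: "Poly_Mapping.single 0 a \<in> homog V 0" "Poly_Mapping.single 1 x \<in> homog V 1"
      using that by (auto simp: homog_def)
    have "G f = G (Poly_Mapping.single 0 a) + G (Poly_Mapping.single 1 x)"
      using that single_in_T by (auto simp: linear_on_def pair_elt_def)
    also have "\<dots> = Poly_Mapping.single 0 (deg0 (G (Poly_Mapping.single 0 a)))
      + Poly_Mapping.single 1 (deg1 (G (Poly_Mapping.single 1 x)))"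
      using homog_eq_single[of "G (Poly_Mapping.single 0 a)" V 0]
        homog_eq_single[of "G (Poly_Mapping.single 1 x)" V 1] that(2) deg by (metis Pi_mem)
    finally show ?thesis by (simp add: pair_elt_def)
  qed
  have "galpha Y f = galpha X f" for f
  proof (cases "f \<in> T")
    case True
    then obtain a x where "a \<in> V 0" "x \<in> V 1" "f = pair_elt a x"
      by (rule T_cases)
    then show ?thesis using diagonal[OF ainf_structure(5,6)] L.galpha_X[of a x]
      by (simp add: X carriers) (simp add: degree_zero_algebra_def degree_one_bimodule_def Let_def)
  qed (use ainf_structure(4) L.galpha_X_linear(1) in \<open>auto simp: X LV PiE_iff extensional_def\<close>)
  moreover have "gbeta Y f = gbeta X f" for f
  proof (cases "f \<in> T")
    case True
    then obtain a x where "a \<in> V 0" "x \<in> V 1" "f = pair_elt a x"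
      by (rule T_cases)
    then show ?thesis using diagonal[OF ainf_structure(8,9)] L.gbeta_X[of a x]
      by (simp add: X carriers) (simp add: degree_zero_algebra_def degree_one_bimodule_def Let_def)
  qed (use ainf_structure(7) L.gbeta_X_linear(1) in \<open>auto simp: X LV PiE_iff extensional_def\<close>)
  moreover have "component Y = component X" by (simp only: X L.component_X LV)
  ultimately have "Y = X" using mult_eq by (intro bihom_ainf.equality) (auto intro: ext)
  then show ?thesis by (simp add: X_def)
qed

end

section \<open>The correspondence\<close>

theorem theorem6p3:
  fixes scale :: "'k::field_char_0 \<Rightarrow> 'v::ab_group_add \<Rightarrow> 'v"
  assumes "vector_space scale"
  shows "bij_betw to_cocycle_tuple (skeletal_two_term_algebras scale) (three_cocycle_tuples scale)"
proof (rule bij_betw_byWitness[where f' = skeletal_algebra])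
  show "\<forall>Y\<in>skeletal_two_term_algebras scale. skeletal_algebra (to_cocycle_tuple Y) = Y"
    using assms skeletal_two_term.skeletal_algebra_to_cocycle_tuple
    by (auto simp: skeletal_two_term_def skeletal_two_term_axioms_def)
  show "\<forall>t\<in>three_cocycle_tuples scale. to_cocycle_tuple (skeletal_algebra t) = t"
    using linear_data_of_cocycle_tuple[OF assms] linear_data.to_cocycle_tuple_skeletal_algebra by fast
  show "skeletal_algebra ` three_cocycle_tuples scale \<subseteq> skeletal_two_term_algebras scale"
    using linear_data_of_cocycle_tuple[OF assms] linear_data.skeletal_algebra_mem_iff by fast
  show "to_cocycle_tuple ` skeletal_two_term_algebras scale \<subseteq> three_cocycle_tuples scale"
  proof (rule image_subsetI)
    fix Y assume "Y \<in> skeletal_two_term_algebras scale"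
    then interpret skeletal_two_term scale Y
      using assms by (simp add: skeletal_two_term_def skeletal_two_term_axioms_def)
    show "to_cocycle_tuple Y \<in> three_cocycle_tuples scale"
      using Y linear_data.skeletal_algebra_mem_iff[OF linear_data_Y] skeletal_algebra_to_cocycle_tuple
      by (simp add: to_cocycle_tuple_def)
  qed
qed

end
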